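(* Let $\lambda$ be a cardinal with $\mathrm{cf}(\lambda)<\lambda=\lambda^{\aleph_0}$. Let $\mathcal F$ be a set of partial functions from $\lambda$ to $\lambda$ such that (i) a partial function $f$ from $\lambda$ to $\lambda$ belongs to $\mathcal F$ if and only if $f\restriction u\in\mathcal F$ for every countable $u\subseteq \mathrm{Dom}(f)$, and (ii) there is no $f\in\mathcal F$ with $\mathrm{Dom}(f)=\lambda$. Let $\mathcal T=\mathcal T_{\mathcal F}$ be the tree whose nodes are the $f\in\mathcal F$ whose domain is an ordinal, ordered by inclusion. Then there are non-isomorphic models $M_1,M_2$ (in a common vocabulary), each of cardinality $\lambda$, which are $EF_{\mathcal T,1}$-equivalent.
   Context: For a tree $\mathcal T$, a cardinal $\mu$ and models $M_1,M_2$ with a common vocabulary, the game $\Game_{\mathcal T,\mu}(M_1,M_2)$ between players ISO and AIS is played in stages $\alpha=0,1,2,\dots$; after stage $\alpha$ there is an increasing continuous sequence $\langle f_\beta:\beta\le\alpha\rangle$ of partial isomorphisms from $M_1$ to $M_2$ and an increasing continuous sequence $\langle z_\beta:\beta\le\alpha\rangle$ in $\mathcal T$. At stage $\alpha$, first AIS chooses a node $z_\alpha$ of level $\alpha$ of $\mathcal T$ with $z_\alpha>^{\mathcal T} z_\beta$ for all $\beta<\alpha$. Then: if $\alpha=0$, $f_0=\emptyset$; if $\alpha$ is limit, $f_\alpha=\bigcup_{\beta<\alpha}f_\beta$; if $\alpha=\beta+1$, AIS chooses $A_1\subseteq M_1$, $A_2\subseteq M_2$ with $|A_1\cup A_2|<1+\mu$,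 and ISO must choose a partial isomorphism $f_\alpha$ from $M_1$ to $M_2$ with $f_\beta\subseteq f_\alpha$, $A_1\subseteq\mathrm{Dom}(f_\alpha)$, $A_2\subseteq\mathrm{Rang}(f_\alpha)$. The first player who cannot make a legal move loses; if ISO never loses, ISO wins. $M_1,M_2$ are $EF_{\mathcal T,\mu}$-equivalent if ISO has a winning strategy in $\Game_{\mathcal T,\mu}(M_1,M_2)$. (So for $\mu=1$, AIS chooses at most one element per successor stage.) *)

theory Defs
  imports "HOL-Library.FuncSet" "HOL-Library.Countable_Set"
begin

unbundle cardinal_syntax

(* The ordinals below a cardinal lam are the elements of Field lam, and the ordinals that are
   subsets of (hence at most) lam are its initial segments, i.e. the sets A with ofilter lam A. *)

section \<open>Cofinality\<close>

(* Unlike the library's cofinal, which asks for strict upper bounds, this gives the usual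
   value 1 for cf of a successor order. *)
definition unbounded_in :: "'a rel \<Rightarrow> 'a set \<Rightarrow> bool" where
  "unbounded_in r K \<longleftrightarrow> K \<subseteq> Field r \<and> (\<forall>a\<in>Field r. \<exists>b\<in>K. (a, b) \<in> r)"

definition cf :: "'a rel \<Rightarrow> 'a rel" where
  "cf r = |SOME K. unbounded_in r K \<and> (\<forall>L. unbounded_in r L \<longrightarrow> |K| \<le>o |L| )|"

section \<open>Models and partial isomorphisms\<close>

record 's vocabulary =
  rel_arity :: "'s \<rightharpoonup> nat"
  fun_arity :: "'s \<rightharpoonup> nat"

record ('s, 'a) model =
  univ :: "'a set"
  rel_of :: "'s \<Rightarrow> 'a list set"
  fun_of :: "'s \<Rightarrow> 'a list \<Rightarrow> 'a"

definition tuples :: "'a set \<Rightarrow> nat \<Rightarrow> 'a list set" where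
  "tuples A n = {xs. set xs \<subseteq> A \<and> length xs = n}"

definition is_model :: "'s vocabulary \<Rightarrow> ('s, 'a) model \<Rightarrow> bool" where
  "is_model V M \<longleftrightarrow>
     univ M \<noteq> {} \<and>
     (\<forall>R n. rel_arity V R = Some n \<longrightarrow> rel_of M R \<subseteq> tuples (univ M) n) \<and>
     (\<forall>G n. fun_arity V G = Some n \<longrightarrow> (\<forall>xs\<in>tuples (univ M) n. fun_of M G xs \<in> univ M))"

definition isomorphism ::
    "'s vocabulary \<Rightarrow> ('s, 'a) model \<Rightarrow> ('s, 'b) model \<Rightarrow> ('a \<Rightarrow> 'b) \<Rightarrow> bool" where
  "isomorphism V M N h \<longleftrightarrow>
     bij_betw h (univ M) (univ N) \<and>
     (\<forall>R n. rel_arity V R = Some n \<longrightarrow>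
        (\<forall>xs\<in>tuples (univ M) n. xs \<in> rel_of M R \<longleftrightarrow> map h xs \<in> rel_of N R)) \<and>
     (\<forall>G n. fun_arity V G = Some n \<longrightarrow>
        (\<forall>xs\<in>tuples (univ M) n. h (fun_of M G xs) = fun_of N G (map h xs)))"

definition isomorphic :: "'s vocabulary \<Rightarrow> ('s, 'a) model \<Rightarrow> ('s, 'b) model \<Rightarrow> bool" where
  "isomorphic V M N \<longleftrightarrow> (\<exists>h. isomorphism V M N h)"

(* The domain need not be closed under the functions; a function symbol is treated as its
   graph. *)
definition partial_iso ::
    "'s vocabulary \<Rightarrow> ('s, 'a) model \<Rightarrow> ('s, 'b) model \<Rightarrow> ('a \<rightharpoonup> 'b) \<Rightarrow> bool" where
  "partial_iso V M N p \<longleftrightarrow>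
     dom p \<subseteq> univ M \<and> ran p \<subseteq> univ N \<and> inj_on p (dom p) \<and>
     (\<forall>R n. rel_arity V R = Some n \<longrightarrow>
        (\<forall>xs\<in>tuples (dom p) n. xs \<in> rel_of M R \<longleftrightarrow> map (the \<circ> p) xs \<in> rel_of N R)) \<and>
     (\<forall>G n. fun_arity V G = Some n \<longrightarrow>
        (\<forall>xs\<in>tuples (dom p) n. \<forall>y\<in>dom p.
           fun_of M G xs = y \<longleftrightarrow> fun_of N G (map (the \<circ> p) xs) = the (p y)))"

section \<open>Trees and the game\<close>

(* A tree is given by its reflexive order; its nodes are the elements of the field. *)
definition is_tree :: "'n rel \<Rightarrow> bool" where
  "is_tree T \<longleftrightarrow> Partial_order T \<and> (\<forall>x\<in>Field T. Well_order (Restr T (underS T x)))"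

(* The elements of this well-order serve as the ordinals below |T|^+. These include the level
   of every node (ex_at_level below), and no play gets through all of them. *)
definition stages :: "'n rel \<Rightarrow> 'n set rel" where
  "stages T = cardSuc |Field T|"

definition at_level :: "'n rel \<Rightarrow> 'n set \<Rightarrow> 'n \<Rightarrow> bool" where
  "at_level T \<alpha> x \<longleftrightarrow> x \<in> Field T \<and>
     Restr T (underS T x) =o Restr (stages T) (underS (stages T) \<alpha>)"

definition is_zero :: "'i rel \<Rightarrow> 'i \<Rightarrow> bool" where
  "is_zero s \<alpha> \<longleftrightarrow> \<alpha> \<in> Field s \<and> underS s \<alpha> = {}"

definition succ_of :: "'i rel \<Rightarrow> 'i \<Rightarrow> 'i \<Rightarrow> bool" where
  "succ_of s \<beta> \<alpha> \<longleftrightarrow> \<alpha> \<in> Field s \<and> \<beta> \<in> Field s \<and> underS s \<alpha> = under s \<beta>"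

definition is_limit :: "'i rel \<Rightarrow> 'i \<Rightarrow> bool" where
  "is_limit s \<alpha> \<longleftrightarrow> \<alpha> \<in> Field s \<and> \<not> is_zero s \<alpha> \<and> (\<nexists>\<beta>. succ_of s \<beta> \<alpha>)"

(* In a play, z \<alpha>, A1 \<alpha>, A2 \<alpha> and f \<alpha> are the node, the two sets and the partial isomorphism of
   stage \<alpha>. At stages that are not successors AIS chooses no sets, which is encoded by
   A1 \<alpha> = A2 \<alpha> = {}. Since z \<alpha> has level \<alpha> and lies above all earlier nodes, its predecessors
   are exactly the earlier nodes; this is the continuity of the sequence z. *)
definition legal_AIS ::
    "'n rel \<Rightarrow> 'm rel \<Rightarrow> ('s, 'a) model \<Rightarrow> ('s, 'a) model \<Rightarrow>
     ('n set \<Rightarrow> 'n) \<Rightarrow> ('n set \<Rightarrow> 'a set) \<Rightarrow> ('n set \<Rightarrow> 'a set) \<Rightarrow> 'n set \<Rightarrow> bool" where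
  "legal_AIS T \<mu> M1 M2 z A1 A2 \<alpha> \<longleftrightarrow>
     at_level T \<alpha> (z \<alpha>) \<and>
     (\<forall>\<beta>\<in>underS (stages T) \<alpha>. (z \<beta>, z \<alpha>) \<in> T \<and> z \<beta> \<noteq> z \<alpha>) \<and>
     (if \<exists>\<beta>. succ_of (stages T) \<beta> \<alpha>
      then A1 \<alpha> \<subseteq> univ M1 \<and> A2 \<alpha> \<subseteq> univ M2 \<and> |A1 \<alpha> \<union> A2 \<alpha>| <o cone +c \<mu>
      else A1 \<alpha> = {} \<and> A2 \<alpha> = {})"

(* At stage 0 and at limit stages f \<alpha> is prescribed by the rules, but it still has to be a
   partial isomorphism. *)
definition legal_ISO ::
    "'n rel \<Rightarrow> 's vocabulary \<Rightarrow> ('s, 'a) model \<Rightarrow> ('s, 'a) model \<Rightarrow>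
     ('n set \<Rightarrow> 'a set) \<Rightarrow> ('n set \<Rightarrow> 'a set) \<Rightarrow> ('n set \<Rightarrow> 'a \<rightharpoonup> 'a) \<Rightarrow> 'n set \<Rightarrow> bool" where
  "legal_ISO T V M1 M2 A1 A2 f \<alpha> \<longleftrightarrow>
     partial_iso V M1 M2 (f \<alpha>) \<and>
     (\<forall>\<beta>. succ_of (stages T) \<beta> \<alpha> \<longrightarrow>
        f \<beta> \<subseteq>\<^sub>m f \<alpha> \<and> A1 \<alpha> \<subseteq> dom (f \<alpha>) \<and> A2 \<alpha> \<subseteq> ran (f \<alpha>))"

(* A strategy gets the stage, the nodes and sets chosen by AIS up to and including that stage,
   and the earlier partial isomorphisms. *)
type_synonym ('n, 'a) strategy =
  "'n set \<Rightarrow> ('n set \<Rightarrow> 'n) \<Rightarrow> ('n set \<Rightarrow> 'a set) \<Rightarrow> ('n set \<Rightarrow> 'a set) \<Rightarrow>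
   ('n set \<Rightarrow> 'a \<rightharpoonup> 'a) \<Rightarrow> ('a \<rightharpoonup> 'a)"

definition follows ::
    "'n rel \<Rightarrow> ('n, 'a) strategy \<Rightarrow> ('n set \<Rightarrow> 'n) \<Rightarrow> ('n set \<Rightarrow> 'a set) \<Rightarrow>
     ('n set \<Rightarrow> 'a set) \<Rightarrow> ('n set \<Rightarrow> 'a \<rightharpoonup> 'a) \<Rightarrow> 'n set \<Rightarrow> bool" where
  "follows T \<sigma> z A1 A2 f \<alpha> \<longleftrightarrow>
     (is_zero (stages T) \<alpha> \<longrightarrow> f \<alpha> = Map.empty) \<and>
     (is_limit (stages T) \<alpha> \<longrightarrow>
        Map.graph (f \<alpha>) = (\<Union>\<beta>\<in>underS (stages T) \<alpha>. Map.graph (f \<beta>))) \<and>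
     ((\<exists>\<beta>. succ_of (stages T) \<beta> \<alpha>) \<longrightarrow>
        f \<alpha> = \<sigma> \<alpha> (restrict z (under (stages T) \<alpha>))
                  (restrict A1 (under (stages T) \<alpha>))
                  (restrict A2 (under (stages T) \<alpha>))
                  (restrict f (underS (stages T) \<alpha>)))"

definition winning_ISO ::
    "'n rel \<Rightarrow> 'm rel \<Rightarrow> 's vocabulary \<Rightarrow> ('s, 'a) model \<Rightarrow> ('s, 'a) model \<Rightarrow>
     ('n, 'a) strategy \<Rightarrow> bool" where
  "winning_ISO T \<mu> V M1 M2 \<sigma> \<longleftrightarrow>
     (\<forall>z A1 A2 f. \<forall>\<alpha>\<in>Field (stages T).
        (\<forall>\<beta>\<in>under (stages T) \<alpha>. legal_AIS T \<mu> M1 M2 z A1 A2 \<beta> \<and> follows T \<sigma> z A1 A2 f \<beta>)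
        \<longrightarrow> legal_ISO T V M1 M2 A1 A2 f \<alpha>)"

definition EF_equivalent ::
    "'n rel \<Rightarrow> 'm rel \<Rightarrow> 's vocabulary \<Rightarrow> ('s, 'a) model \<Rightarrow> ('s, 'a) model \<Rightarrow> bool" where
  "EF_equivalent T \<mu> V M1 M2 \<longleftrightarrow> (\<exists>\<sigma>. winning_ISO T \<mu> V M1 M2 \<sigma>)"

section \<open>The tree of a family of partial functions\<close>

definition tree_nodes :: "'a rel \<Rightarrow> ('a \<rightharpoonup> 'a) set \<Rightarrow> ('a \<rightharpoonup> 'a) set" where
  "tree_nodes lam F = {f \<in> F. ofilter lam (dom f)}"

definition tree_of :: "'a rel \<Rightarrow> ('a \<rightharpoonup> 'a) set \<Rightarrow> ('a \<rightharpoonup> 'a) rel" where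
  "tree_of lam F = {(f, g). f \<in> tree_nodes lam F \<and> g \<in> tree_nodes lam F \<and> f \<subseteq>\<^sub>m g}"

section \<open>Adequacy of the definitions\<close>

lemma cf_attained:
  assumes "Well_order r"
  obtains K where "cf r = |K|" "unbounded_in r K" "\<And>L. unbounded_in r L \<Longrightarrow> |K| \<le>o |L|"
proof -
  let ?C = "{|L| | L. unbounded_in r L}"
  have "unbounded_in r (Field r)"
    using assms unfolding unbounded_in_def order_on_defs refl_on_def by auto
  hence ne: "?C \<noteq> {}" by blast
  have wo: "\<forall>c\<in>?C. Well_order c" using card_of_Well_order by auto
  obtain K where K: "unbounded_in r K" "\<forall>c\<in>?C. |K| \<le>o c"
    using exists_minim_Well_order[OF ne wo] by auto
  hence "\<exists>K. unbounded_in r K \<and> (\<forall>L. unbounded_in r L \<longrightarrow> |K| \<le>o |L| )" by blast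
  from someI_ex[OF this] show ?thesis
    using that[OF cf_def] by blast
qed

lemma ex_at_level:
  assumes "is_tree T" "x \<in> Field T"
  shows "\<exists>\<alpha>\<in>Field (stages T). at_level T \<alpha> x"
proof -
  let ?p = "Restr T (underS T x)"
  have wo: "Well_order ?p" using assms by (auto simp: is_tree_def)
  have cs: "Card_order (stages T)" "|Field T| <o stages T"
    by (simp_all add: stages_def cardSuc_Card_order cardSuc_greater card_of_Card_order)
  have "Field ?p \<subseteq> Field T" by (auto simp: Field_def)
  hence "|Field ?p| \<le>o |Field T|" by (rule card_of_mono1)
  hence less: "|Field ?p| <o stages T" using cs(2) ordLeq_ordLess_trans by blast
  have wos: "Well_order (stages T)" using cs(1) card_order_on_well_order_on by blast
  have "?p <o stages T"
  proof (rule ccontr)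
    assume "\<not> ?p <o stages T"
    hence "stages T \<le>o ?p" using wo wos not_ordLess_iff_ordLeq by blast
    hence "|Field (stages T)| \<le>o |Field ?p|" by (rule card_of_mono2)
    moreover have "|Field (stages T)| =o stages T" using cs(1) by (rule card_of_Field_ordIso)
    ultimately have "stages T \<le>o |Field ?p|"
      using ordIso_ordLeq_trans ordIso_symmetric by blast
    thus False using less not_ordLess_ordLeq by blast
  qed
  thus ?thesis
    using ordLess_iff_ordIso_Restr[OF wos wo] assms(2) by (auto simp: at_level_def)
qed

lemma Field_tree_of: "Field (tree_of lam F) = tree_nodes lam F"
  by (auto simp: tree_of_def Field_def)

lemma is_tree_tree_of:
  assumes "Well_order lam"
  shows "is_tree (tree_of lam F)"
proof -
  let ?T = "tree_of lam F"
  have po: "Partial_order ?T"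
    unfolding order_on_defs Field_tree_of
  proof (intro conjI)
    show "refl_on (tree_nodes lam F) ?T"
      by (auto simp: refl_on_def tree_of_def)
    show "?T \<subseteq> tree_nodes lam F \<times> tree_nodes lam F"
      by (auto simp: tree_of_def)
    show "trans ?T"
      by (rule transI) (use map_le_trans in \<open>auto simp: tree_of_def\<close>)
    show "antisym ?T"
      by (rule antisymI) (simp add: tree_of_def map_le_antisym)
  qed
  have seg: "dom f \<subseteq> dom g \<or> dom g \<subseteq> dom f"
    if "f \<in> tree_nodes lam F" "g \<in> tree_nodes lam F" for f g
    using that wo_rel.ofilter_linord[of lam] assms by (auto simp: tree_nodes_def wo_rel_def)
  have dom_neq: "dom f \<noteq> dom g" if "f \<subseteq>\<^sub>m g" "f \<noteq> g" for f g :: "'a \<rightharpoonup> 'a"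
  proof
    assume "dom f = dom g"
    hence "g \<subseteq>\<^sub>m f" using that(1) by (simp add: map_le_def)
    thus False using that map_le_antisym by blast
  qed
  have "Well_order (Restr ?T (underS ?T x))" for x
  proof -
    let ?p = "Restr ?T (underS ?T x)"
    have mem: "f \<in> tree_nodes lam F \<and> f \<subseteq>\<^sub>m x \<and> f \<noteq> x"
      if "f \<in> underS ?T x" for f
      using that by (simp add: underS_def tree_of_def)
    have F: "Field ?p = underS ?T x"
      by (rule Refl_Field_Restr2) (use po in \<open>auto simp: order_on_defs underS_def Field_def\<close>)
    have comp: "f \<subseteq>\<^sub>m g" if "f \<in> underS ?T x" "g \<in> underS ?T x" "dom f \<subseteq> dom g" for f g
      using mem[OF that(1)] mem[OF that(2)] that(3)
      unfolding map_le_def by (simp add: subset_iff)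
    have "(f, g) \<in> ?p \<or> (g, f) \<in> ?p" if "f \<in> underS ?T x" "g \<in> underS ?T x" for f g
    proof -
      have "f \<subseteq>\<^sub>m g \<or> g \<subseteq>\<^sub>m f"
        using seg[of f g] mem[OF that(1)] mem[OF that(2)] comp[OF that] comp[OF that(2) that(1)]
        by argo
      moreover have "f \<in> tree_nodes lam F" "g \<in> tree_nodes lam F"
        using mem that by blast+
      ultimately show ?thesis using that by (simp add: tree_of_def)
    qed
    hence tot: "total_on (underS ?T x) ?p"
      unfolding total_on_def by blast
    have "Partial_order ?p" using po Partial_order_Restr by blast
    hence lo: "Linear_order ?p" using tot F by (simp add: order_on_defs)
    have proper: "ofilter lam (dom f) \<and> dom f \<noteq> Field lam" if "f \<in> underS ?T x" for f
    proof -
      have "dom f \<subset> dom x" "ofilter lam (dom f)"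
        using mem[OF that] dom_neq[of f x] map_le_implies_dom_le[of f x]
        by (simp_all add: tree_nodes_def psubset_eq)
      moreover have "dom x \<subseteq> Field lam"
        using that by (simp add: underS_def tree_of_def tree_nodes_def ofilter_def)
      ultimately show ?thesis by blast
    qed
    have "?p - Id \<subseteq> inv_image (ofilterIncl lam) dom"
    proof
      fix q assume q: "q \<in> ?p - Id"
      obtain f g where fg: "q = (f, g)" by (cases q)
      have "f \<in> underS ?T x" "g \<in> underS ?T x" "f \<subseteq>\<^sub>m g" "f \<noteq> g"
        using q fg by (simp_all add: tree_of_def)
      thus "q \<in> inv_image (ofilterIncl lam) dom"
        using fg proper dom_neq[of f g] map_le_implies_dom_le[of f g]
        by (simp add: ofilterIncl_def psubset_eq)
    qed
    hence "wf (?p - Id)"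
      by (rule wf_subset[OF wf_inv_image[OF wf_ofilterIncl[OF assms]]])
    thus ?thesis using lo F by (simp add: well_order_on_def)
  qed
  thus ?thesis using po by (simp add: is_tree_def)
qed

end

theory Submission
  imports Defs "HOL-Library.Countable_Set_Type"
begin

text \<open>For a countable \<open>a\<close>, the points over \<open>a\<close> are the finite sets of functions with domain
  \<open>a\<close>, and smaller domains are reached by restriction, counted modulo two. The two models differ
  only in a predicate for the even, respectively odd, sets of good functions. An isomorphism moves
  the empty sets to a coherent system of finite odd sets, hence nonempty ones, from which a total
  function with good countable restrictions can be extracted. Such a function would give an element
  of \<open>F\<close> defined on all of \<open>lam\<close>.

  In the game ISO builds a partial such function along the nodes chosen by AIS and answers by taking
  the symmetric difference with the singletons of its restrictions. The total function is forced to
  reach every point of \<open>lam\<close> since each index carries its own label \<open>(t, n)\<close> with \<open>n\<close> a natural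
  number, and \<open>t\<close> a point up to which the values of the node are revealed; \<open>lam\<close> many labels cannot
  all have \<open>t\<close> below a fixed point. The labels stay distinct because AIS asks for only one element
  per stage, that is, for countably many indices.\<close>

section \<open>Cardinalities\<close>

text \<open>A nonempty countable subset of \<open>A\<close> is the range of a sequence in
  \<open>A\<close>, so there are at most \<open>|A| ^c natLeq\<close> of them. The empty set is
  counted separately.\<close>

lemma card_of_countable_subsets_le:
  assumes "Card_order r" "infinite (Field r)" "r ^c natLeq \<le>o r" "|A| \<le>o r"
  shows "|{X. X \<subseteq> A \<and> countable X}| \<le>o r"
proof -
  have "|A| ^c natLeq \<le>o r ^c natLeq"
    using assms(4) natLeq_Card_order by (rule cexp_mono1)
  hence "|{X. X \<subseteq> A \<and> countable X \<and> X \<noteq> {}}| \<le>o r"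
    by (rule ordLeq_transitive[OF card_of_countable_sets_Func
          ordLeq_transitive[OF _ assms(3)]])
  moreover have "|{{}::'b set}| \<le>o r"
    by (rule Card_order_singl_ordLeq) (use assms in auto)
  ultimately have "|{{}} \<union> {X. X \<subseteq> A \<and> countable X \<and> X \<noteq> {}}| \<le>o r"
    using assms by (intro card_of_Un_ordLeq_infinite_Field) auto
  moreover have "{X. X \<subseteq> A \<and> countable X} = {{}} \<union> {X. X \<subseteq> A \<and> countable X \<and> X \<noteq> {}}"
    by auto
  ultimately show ?thesis by simp
qed

text \<open>By \<open>cf lam <o lam\<close> some point lies outside a smallest unbounded set
  \<open>K\<close>, and some element of \<open>K\<close> lies above it. These two elements bound
  \<open>ctwo ^c natLeq\<close> by \<open>lam ^c natLeq\<close>, which is \<open>lam\<close>;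
  Cantor's theorem gives strictness.\<close>

lemma natLeq_ordLess_if_cexp_eq:
  assumes "Card_order lam" "cf lam <o lam" "lam =o lam ^c natLeq"
  shows "natLeq <o lam"
proof -
  have wo: "Well_order lam" using assms(1) by (simp add: card_order_on_well_order_on)
  obtain K where K: "cf lam = |K|" "unbounded_in lam K"
    using cf_attained[OF wo] by metis
  have K1: "K \<subseteq> Field lam" and K2: "\<And>a. a \<in> Field lam \<Longrightarrow> \<exists>b\<in>K. (a, b) \<in> lam"
    using K(2) by (auto simp: unbounded_in_def)
  have "K \<noteq> Field lam"
  proof
    assume "K = Field lam"
    hence "|K| =o lam" using card_of_Field_ordIso[OF assms(1)] by simp
    thus False using assms(2) K(1) not_ordLess_ordIso by auto
  qed
  then obtain x where x: "x \<in> Field lam" "x \<notin> K" using K1 by blast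
  obtain y where y: "y \<in> K" using K2[OF x(1)] by blast
  have "|UNIV :: bool set| \<le>o |Field lam|"
    by (rule card_of_ordLeqI[of "\<lambda>b. if b then x else y"])
      (use x y K1 in \<open>auto simp: inj_on_def\<close>)
  hence "ctwo \<le>o lam"
    unfolding ctwo_def using card_of_Field_ordIso[OF assms(1)] ordLeq_ordIso_trans by blast
  hence "ctwo ^c natLeq \<le>o lam ^c natLeq"
    using natLeq_Card_order by (rule cexp_mono1)
  hence "ctwo ^c natLeq \<le>o lam"
    using assms(3) ordIso_symmetric ordLeq_ordIso_trans by blast
  thus ?thesis
    using ordLess_ctwo_cexp[OF natLeq_Card_order] ordLess_ordLeq_trans by blast
qed

lemma countable_if_ordLess_cone_csum_cone:
  assumes "|A| <o cone +c cone"
  shows "countable A"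
proof -
  have "|A| \<le>o |Field (cone :: unit rel) <+> Field (cone :: unit rel)|"
    using assms unfolding csum_def cone_def by (simp add: ordLess_imp_ordLeq)
  hence "finite A"
    by (rule card_of_ordLeq_finite) (simp add: cone_def Field_card_of)
  thus ?thesis by (rule countable_finite)
qed

section \<open>Finite sets of functions modulo two\<close>

text \<open>Finite sets of functions are vectors over the two-element field; on them this is the
  linear map that restriction to \<open>b\<close> induces on basis vectors.\<close>

definition proj :: "'d set \<Rightarrow> ('d \<rightharpoonup> 'e) set \<Rightarrow> ('d \<rightharpoonup> 'e) set" where
  "proj b S = {c. odd (card {d\<in>S. d |` b = c})}"

text \<open>Addition of the basis vector \<open>c\<close> over the two-element field.\<close>

definition toggle :: "'c \<Rightarrow> 'c set \<Rightarrow> 'c set" where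
  "toggle c S = (if c \<in> S then S - {c} else insert c S)"

lemma toggle_toggle [simp]: "toggle c (toggle c S) = S"
  by (auto simp: toggle_def)

lemma finite_toggle [simp]: "finite (toggle c S) \<longleftrightarrow> finite S"
  by (simp add: toggle_def)

lemma toggle_subset_iff: "c \<in> A \<Longrightarrow> toggle c S \<subseteq> A \<longleftrightarrow> S \<subseteq> A"
  by (auto simp: toggle_def)

lemma odd_card_toggle:
  assumes "finite S"
  shows "odd (card (toggle c S)) \<longleftrightarrow> even (card S)"
proof (cases "c \<in> S")
  case True
  hence "card S = Suc (card (S - {c}))" using assms by (metis card_Suc_Diff1)
  thus ?thesis using True by (simp add: toggle_def)
next
  case False
  thus ?thesis using assms by (simp add: toggle_def)
qed

lemma proj_subset_image: "proj b S \<subseteq> (\<lambda>d. d |` b) ` S"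
proof
  fix c assume "c \<in> proj b S"
  hence "card {d\<in>S. d |` b = c} \<noteq> 0" unfolding proj_def by (intro notI) simp
  hence "{d\<in>S. d |` b = c} \<noteq> {}" by (intro notI) simp
  thus "c \<in> (\<lambda>d. d |` b) ` S" by blast
qed

lemma proj_empty [simp]: "proj b {} = {}"
  by (simp add: proj_def)

text \<open>Additivity of the projection: only the count over the restriction of \<open>c\<close>
  changes, by one.\<close>

lemma proj_toggle:
  assumes "finite S"
  shows "proj b (toggle c S) = toggle (c |` b) (proj b S)"
proof -
  have "x \<in> proj b (toggle c S) \<longleftrightarrow> x \<in> toggle (c |` b) (proj b S)" for x
  proof (cases "c |` b = x")
    case True
    have "{d\<in>toggle c S. d |` b = x} = toggle c {d\<in>S. d |` b = x}"
      using True by (auto simp: toggle_def)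
    moreover have "finite {d\<in>S. d |` b = x}" using assms by simp
    ultimately have "x \<in> proj b (toggle c S) \<longleftrightarrow> x \<notin> proj b S"
      using odd_card_toggle by (simp add: proj_def)
    thus ?thesis using True by (auto simp: toggle_def)
  next
    case False
    have "{d\<in>toggle c S. d |` b = x} = {d\<in>S. d |` b = x}"
      using False by (auto simp: toggle_def)
    thus ?thesis using False by (auto simp: toggle_def proj_def)
  qed
  thus ?thesis by blast
qed

lemma proj_card_le: "finite S \<Longrightarrow> card (proj b S) \<le> card S"
  by (rule surj_card_le[OF _ proj_subset_image])

text \<open>The projection lies in the image of \<open>S\<close> under restriction, which is no
  larger than \<open>S\<close>. Equal cardinalities therefore exclude both collisions and
  cancellation.\<close>

lemma proj_eq_card:
  assumes "finite S" "card S \<le> card (proj b S)"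
  shows "inj_on (\<lambda>d. d |` b) S" "proj b S = (\<lambda>d. d |` b) ` S"
proof -
  let ?r = "\<lambda>d. d |` b"
  have 1: "card (proj b S) \<le> card (?r ` S)"
    by (rule card_mono) (use assms(1) proj_subset_image in auto)
  have 2: "card (?r ` S) \<le> card S" using assms(1) by (rule card_image_le)
  show "inj_on ?r S"
    by (rule eq_card_imp_inj_on) (use 1 2 assms in auto)
  show "proj b S = ?r ` S"
    by (rule card_subset_eq) (use 1 2 assms proj_subset_image in auto)
qed

text \<open>The witness only has to agree with \<phi> on \<open>a\<close> and may have a larger
  domain; this lets the extraction below use functions on \<open>a \<union> a0\<close>.\<close>

definition thread :: "'d set \<Rightarrow> ('d \<rightharpoonup> 'e) set \<Rightarrow> ('d \<Rightarrow> 'e) \<Rightarrow> bool" where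
  "thread D K \<phi> \<longleftrightarrow>
     (\<forall>a. a \<subseteq> D \<and> countable a \<longrightarrow> (\<exists>c\<in>K. \<forall>d\<in>a. c d = Some (\<phi> d)))"

text \<open>The countable subsets of \<open>D\<close> are \<open>\<sigma>\<close>-directed, so the cardinalities of a coherent system
  of finite sets attain a maximum; beyond it the projections are bijections, and any element at
  the maximum extends uniquely to a thread.\<close>

lemma thread_of_coherent_odd_system:
  fixes g :: "'d set \<Rightarrow> ('d \<rightharpoonup> 'e) set"
  assumes fin: "\<And>a. a \<subseteq> D \<Longrightarrow> countable a \<Longrightarrow> finite (g a)"
    and odd: "\<And>a. a \<subseteq> D \<Longrightarrow> countable a \<Longrightarrow> odd (card (g a))"
    and dom: "\<And>a c. a \<subseteq> D \<Longrightarrow> countable a \<Longrightarrow> c \<in> g a \<Longrightarrow> dom c = a"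
    and K: "\<And>a. a \<subseteq> D \<Longrightarrow> countable a \<Longrightarrow> g a \<subseteq> K"
    and coh: "\<And>a b. a \<subseteq> D \<Longrightarrow> countable a \<Longrightarrow> b \<subseteq> a \<Longrightarrow> g b = proj b (g a)"
  shows "\<exists>\<phi>. thread D K \<phi>"
proof -
  define I where "I = {a. a \<subseteq> D \<and> countable a}"
  have mono: "card (g b) \<le> card (g a)" if "a \<in> I" "b \<subseteq> a" for a b
    using that coh[of a b] fin[of a] by (simp add: I_def proj_card_le)
  have "\<exists>N. \<forall>a\<in>I. card (g a) \<le> N"
  proof (rule ccontr)
    assume "\<not> ?thesis"
    hence "\<forall>n. \<exists>a\<in>I. n < card (g a)" by (meson not_le)
    then obtain A where A: "\<And>n. A n \<in> I" "\<And>n. n < card (g (A n))" by metis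
    have "(\<Union>n. A n) \<in> I" using A(1) by (auto simp: I_def)
    hence "card (g (A n)) \<le> card (g (\<Union>n. A n))" for n by (rule mono) blast
    thus False using A(2) by (meson leD)
  qed
  then obtain N where N: "\<And>a. a \<in> I \<Longrightarrow> card (g a) < Suc N" by (auto simp: less_Suc_eq_le)
  have "{} \<in> I" by (simp add: I_def)
  then obtain a0 where a0: "a0 \<in> I" "\<And>a. a \<in> I \<Longrightarrow> card (g a) \<le> card (g a0)"
    using ex_has_greatest_nat[of "\<lambda>a. a \<in> I" "{}" "\<lambda>a. card (g a)" "Suc N"] N by blast
  have max: "card (g a) = card (g a0)" if "a \<in> I" "a0 \<subseteq> a" for a
    using a0(2)[OF that(1)] mono[OF that] by simp
  have bij: "inj_on (\<lambda>c. c |` b) (g a)" "g b = (\<lambda>c. c |` b) ` g a"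
    if "a \<in> I" "a0 \<subseteq> b" "b \<subseteq> a" for a b
  proof -
    have b: "b \<in> I" using that(1,3) by (auto simp: I_def intro: countable_subset)
    have "card (g a) \<le> card (proj b (g a))" "finite (g a)" "g b = proj b (g a)"
      using max[of a] max[OF b that(2)] that coh[of a b] fin[of a] by (auto simp: I_def)
    thus "inj_on (\<lambda>c. c |` b) (g a)" "g b = (\<lambda>c. c |` b) ` g a"
      using proj_eq_card[of "g a" b] by simp_all
  qed
  \<comment> \<open>Oddness enters here, as it excludes the empty set.\<close>
  have "g a0 \<noteq> {}" using a0(1) odd[of a0] by (auto simp: I_def)
  then obtain c0 where c0: "c0 \<in> g a0" by blast
  have ext: "\<exists>c\<in>g a. c |` a0 = c0" if "a \<in> I" "a0 \<subseteq> a" for a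
  proof -
    have "c0 \<in> (\<lambda>c. c |` a0) ` g a"
      using bij(2)[OF that(1) subset_refl that(2)] c0 by simp
    thus ?thesis by blast
  qed
  have ins: "insert d a0 \<in> I" if "d \<in> D" for d
    using that a0(1) by (auto simp: I_def)
  have "\<forall>d\<in>D. \<exists>c. c \<in> g (insert d a0) \<and> c |` a0 = c0"
    using ext ins by blast
  then obtain C where C: "\<And>d. d \<in> D \<Longrightarrow> C d \<in> g (insert d a0)" "\<And>d. d \<in> D \<Longrightarrow> C d |` a0 = c0"
    by metis
  \<comment> \<open>The value at \<open>d\<close> is read from the unique extension of
    \<open>c0\<close> to \<open>insert d a0\<close>. An extension of \<open>c0\<close> to
    \<open>a \<union> a0\<close> restricts to all of these at once, so it witnesses agreement on
    \<open>a\<close>.\<close>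
  have "thread D K (\<lambda>d. the (C d d))"
    unfolding thread_def
  proof (intro allI impI)
    fix a assume a: "a \<subseteq> D \<and> countable a"
    have I: "a \<union> a0 \<in> I" using a a0(1) by (auto simp: I_def)
    then obtain c where c: "c \<in> g (a \<union> a0)" "c |` a0 = c0" using ext[of "a \<union> a0"] by blast
    have "c d = Some (the (C d d))" if d: "d \<in> a" for d
    proof -
      have dD: "d \<in> D" using d a by blast
      have sub: "insert d a0 \<subseteq> a \<union> a0" using d by blast
      have "c |` insert d a0 \<in> g (insert d a0)"
        using bij(2)[OF I _ sub] c(1) by auto
      moreover have "(c |` insert d a0) |` a0 = C d |` a0"
        using c(2) C(2)[OF dD] by (simp add: Int_absorb1 subset_insertI)
      ultimately have "c |` insert d a0 = C d"
        using inj_onD[OF bij(1)[OF ins[OF dD] subset_refl subset_insertI]] C(1)[OF dD] by blast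
      hence "c d = C d d" by (metis insertI1 restrict_in)
      moreover have "d \<in> dom c"
        using dom[of "a \<union> a0" c] I c(1) d by (auto simp: I_def)
      ultimately show ?thesis by (metis domD option.sel)
    qed
    moreover have "c \<in> K" using K[of "a \<union> a0"] I c(1) by (auto simp: I_def)
    ultimately show "\<exists>c\<in>K. \<forall>d\<in>a. c d = Some (the (C d d))" by blast
  qed
  thus ?thesis by blast
qed

section \<open>The parity models\<close>

text \<open>The fibre over \<open>a\<close> has as its basis all functions from \<open>a\<close> to
  \<open>E\<close>, good or not; goodness is left to a predicate of the models.\<close>

definition fibre_points :: "'d set \<Rightarrow> 'e set \<Rightarrow> ('d set \<times> ('d \<rightharpoonup> 'e) set) set" where
  "fibre_points D E =
     {(a, S). a \<subseteq> D \<and> countable a \<and> finite S \<and> (\<forall>c\<in>S. dom c = a \<and> ran c \<subseteq> E)}"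

lemma proj_fibre_points:
  assumes "(a, S) \<in> fibre_points D E" "b \<subseteq> a"
  shows "(b, proj b S) \<in> fibre_points D E"
proof -
  have "finite (proj b S)"
    using finite_subset[OF proj_subset_image] assms(1) by (auto simp: fibre_points_def)
  moreover have "dom c = b \<and> ran c \<subseteq> E" if "c \<in> proj b S" for c
  proof -
    from subsetD[OF proj_subset_image that]
    obtain d where d: "d \<in> S" "c = d |` b" by blast
    have "dom d = a" "ran d \<subseteq> E" using assms(1) d(1) by (auto simp: fibre_points_def)
    thus ?thesis using d(2) assms(2) by (auto simp: ran_def restrict_map_def split: if_splits)
  qed
  ultimately show ?thesis
    using assms by (auto simp: fibre_points_def intro: countable_subset)
qed

lemma toggle_fibre_points:
  assumes "(a, S) \<in> fibre_points D E" "dom c = a" "ran c \<subseteq> E"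
  shows "(a, toggle c S) \<in> fibre_points D E"
  using assms by (auto simp: fibre_points_def toggle_def)

text \<open>For the upper bound, functions are replaced by their graphs, so that a point becomes a
  countable subset of \<open>D\<close> with a countable set of countable subsets of
  \<open>D \<times> E\<close>. The points \<open>({d}, {})\<close> give the lower bound.\<close>

lemma card_of_fibre_points:
  fixes D :: "'d set" and E :: "'e set"
  assumes r: "Card_order r" "infinite (Field r)" "r ^c natLeq \<le>o r"
    and D: "|D| =o r" and E: "|E| \<le>o r"
  shows "|fibre_points D E| =o r"
proof -
  let ?P = "\<lambda>A. {X. X \<subseteq> A \<and> countable X}"
  have D': "|D| \<le>o r" using D ordIso_imp_ordLeq by blast
  have "|D \<times> E| \<le>o r"
    by (rule card_of_Times_ordLeq_infinite_Field) (use r D' E in auto)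
  hence "|?P (?P (D \<times> E))| \<le>o r"
    by (intro card_of_countable_subsets_le[OF r])
  moreover have "|?P D| \<le>o r" using card_of_countable_subsets_le[OF r D'] .
  ultimately have "|?P D \<times> ?P (?P (D \<times> E))| \<le>o r"
    by (intro card_of_Times_ordLeq_infinite_Field) (use r in auto)
  moreover have "|fibre_points D E| \<le>o |?P D \<times> ?P (?P (D \<times> E))|"
  proof (rule card_of_ordLeqI[of "map_prod id ((`) Map.graph)"])
    have "inj (Map.graph :: ('d \<rightharpoonup> 'e) \<Rightarrow> _)"
    proof (rule injI)
      fix f g :: "'d \<rightharpoonup> 'e"
      assume "Map.graph f = Map.graph g"
      hence "f x = Some y \<longleftrightarrow> g x = Some y" for x y
        unfolding Map.graph_def by blast
      thus "f = g" by (intro ext) (metis not_Some_eq)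
    qed
    hence "inj ((`) (Map.graph :: ('d \<rightharpoonup> 'e) \<Rightarrow> _))"
      by (intro inj_on_image) (rule inj_on_subset[OF _ subset_UNIV])
    hence "inj (map_prod (id :: 'd set \<Rightarrow> _) ((`) (Map.graph :: ('d \<rightharpoonup> 'e) \<Rightarrow> _)))"
      using prod.inj_map inj_on_id by blast
    thus "inj_on (map_prod id ((`) Map.graph)) (fibre_points D E)"
      by (rule inj_on_subset[OF _ subset_UNIV])
    fix p assume p: "p \<in> fibre_points D E"
    obtain a S where aS: "p = (a, S)" by (cases p)
    have "Map.graph c \<subseteq> D \<times> E \<and> countable (Map.graph c)" if "c \<in> S" for c
    proof -
      have c: "dom c = a" "ran c \<subseteq> E" "a \<subseteq> D" "countable a"
        using p aS that by (auto simp: fibre_points_def)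
      thus ?thesis
        by (auto simp: graph_eq_to_snd_dom ran_def)
    qed
    moreover have "countable (Map.graph ` S)"
      using p aS by (auto simp: fibre_points_def countable_finite)
    ultimately show "map_prod id ((`) Map.graph) p \<in> ?P D \<times> ?P (?P (D \<times> E))"
      using p aS by (auto simp: fibre_points_def)
  qed
  ultimately have "|fibre_points D E| \<le>o r" using ordLeq_transitive by blast
  moreover have "|D| \<le>o |fibre_points D E|"
    by (rule card_of_ordLeqI[of "\<lambda>d. ({d}, {})"]) (auto simp: inj_on_def fibre_points_def)
  ultimately show ?thesis
    using D ordIso_iff_ordLeq ordIso_ordLeq_trans ordIso_symmetric by blast
qed

section \<open>Models in a binary relational vocabulary\<close>

definition binary_vocabulary :: "'s vocabulary" where
  "binary_vocabulary = \<lparr>rel_arity = \<lambda>_. Some 2, fun_arity = Map.empty\<rparr>"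

lemma tuples_2: "xs \<in> tuples A 2 \<longleftrightarrow> (\<exists>x\<in>A. \<exists>y\<in>A. xs = [x, y])"
  by (auto simp: tuples_def numeral_2_eq_2 length_Suc_conv)

lemma partial_iso_binary_iff:
  "partial_iso binary_vocabulary M N p \<longleftrightarrow>
     dom p \<subseteq> univ M \<and> ran p \<subseteq> univ N \<and> inj_on p (dom p) \<and>
     (\<forall>R. \<forall>x\<in>dom p. \<forall>y\<in>dom p.
        [x, y] \<in> rel_of M R \<longleftrightarrow> [the (p x), the (p y)] \<in> rel_of N R)"
proof -
  have "(\<forall>xs\<in>tuples (dom p) 2. xs \<in> rel_of M R \<longleftrightarrow> map (the \<circ> p) xs \<in> rel_of N R) \<longleftrightarrow>
    (\<forall>x\<in>dom p. \<forall>y\<in>dom p. [x, y] \<in> rel_of M R \<longleftrightarrow> [the (p x), the (p y)] \<in> rel_of N R)" for R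
    by (force simp: tuples_2)
  thus ?thesis by (simp add: partial_iso_def binary_vocabulary_def)
qed

text \<open>This serves the limit stages of the game, where the map of ISO is only known to lie
  below a translation.\<close>

lemma partial_iso_binary_submap:
  assumes "partial_iso binary_vocabulary M N q" "p \<subseteq>\<^sub>m q"
  shows "partial_iso binary_vocabulary M N p"
proof -
  have eq: "p x = q x" if "x \<in> dom p" for x using assms(2) that by (simp add: map_le_def)
  have dom: "dom p \<subseteq> dom q" using assms(2) by (rule map_le_implies_dom_le)
  have "ran p \<subseteq> ran q" using eq by (force simp: ran_def)
  moreover have "inj_on p (dom p)"
    using assms(1) dom eq by (auto simp: partial_iso_binary_iff inj_on_def) (metis domI subsetD)
  ultimately show ?thesis
    using assms(1) dom eq unfolding partial_iso_binary_iff by (simp add: subset_iff)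
qed

text \<open>The point \<open>(a, S)\<close> is represented by \<open>enc (a, S)\<close>. The symbol \<open>{}\<close> stands for a unary
  predicate, read as a binary relation on the diagonal; the symbol \<open>{enc (b, {})}\<close> stands for the
  projection to the fibre of \<open>b\<close>.\<close>

locale encoded_fibres =
  fixes D :: "'d set" and E :: "'e set" and K :: "('d \<rightharpoonup> 'e) set"
    and enc :: "'d set \<times> ('d \<rightharpoonup> 'e) set \<Rightarrow> 'a"
  assumes inj_enc: "inj_on enc (fibre_points D E)"
begin

abbreviation "pts \<equiv> fibre_points D E"

definition dec :: "'a \<Rightarrow> 'd set \<times> ('d \<rightharpoonup> 'e) set" where
  "dec = the_inv_into pts enc"

lemma dec_enc [simp]: "p \<in> pts \<Longrightarrow> dec (enc p) = p"
  by (simp add: dec_def the_inv_into_f_f inj_enc)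

lemma enc_eq_iff: "p \<in> pts \<Longrightarrow> q \<in> pts \<Longrightarrow> enc p = enc q \<longleftrightarrow> p = q"
  using inj_enc by (auto simp: inj_on_def)

text \<open>The symbols are subsets of the carrier type, so the empty set is available beside the
  singletons that name fibres. Any other symbol denotes the empty relation.\<close>

definition parity_model :: "bool \<Rightarrow> ('a set, 'a) model" where
  "parity_model \<epsilon> = \<lparr>univ = enc ` pts,
     rel_of = \<lambda>R. if R = {}
       then {[enc (a, S), enc (a, S)] | a S. (a, S) \<in> pts \<and> S \<subseteq> K \<and> odd (card S) = \<epsilon>}
       else {[enc (a, S), enc (b, proj b S)] | a S b. (a, S) \<in> pts \<and> b \<subseteq> a \<and> R = {enc (b, {})}},
     fun_of = \<lambda>_ _. undefined\<rparr>"

lemma univ_parity_model [simp]: "univ (parity_model \<epsilon>) = enc ` pts"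
  by (simp add: parity_model_def)

lemma fibre_empty: "a \<subseteq> D \<Longrightarrow> countable a \<Longrightarrow> (a, {}) \<in> pts"
  by (simp add: fibre_points_def)

lemma parity_rel_iff:
  assumes "p \<in> pts" "q \<in> pts"
  shows "[enc p, enc q] \<in> rel_of (parity_model \<epsilon>) {} \<longleftrightarrow>
    p = q \<and> snd p \<subseteq> K \<and> odd (card (snd p)) = \<epsilon>"
  using assms by (cases p) (auto simp: parity_model_def enc_eq_iff)

lemma proj_rel_iff:
  assumes "p \<in> pts" "q \<in> pts" "R \<noteq> {}"
  shows "[enc p, enc q] \<in> rel_of (parity_model \<epsilon>) R \<longleftrightarrow>
    fst q \<subseteq> fst p \<and> R = {enc (fst q, {})} \<and> snd q = proj (fst q) (snd p)"
proof -
  obtain a S b T where p: "p = (a, S)" and q: "q = (b, T)" by fastforce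
  have "[enc p, enc q] \<in> rel_of (parity_model \<epsilon>) R \<longleftrightarrow>
    (\<exists>b'. b' \<subseteq> a \<and> R = {enc (b', {})} \<and> enc q = enc (b', proj b' S))"
    using assms by (auto simp: parity_model_def p enc_eq_iff; blast)
  also have "\<dots> \<longleftrightarrow> (\<exists>b'. b' \<subseteq> a \<and> R = {enc (b', {})} \<and> q = (b', proj b' S))"
    using assms(1,2) proj_fibre_points[of a S D E] enc_eq_iff by (metis p)
  finally show ?thesis by (auto simp: p q)
qed

lemma is_model_parity: "is_model binary_vocabulary (parity_model \<epsilon>)"
proof -
  have "rel_of (parity_model \<epsilon>) R \<subseteq> tuples (enc ` pts) 2" for R
    by (auto simp: parity_model_def tuples_2 split: if_splits
        intro!: imageI intro: proj_fibre_points)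
  moreover have "pts \<noteq> {}" using fibre_empty[of "{}"] by auto
  ultimately show ?thesis by (auto simp: is_model_def binary_vocabulary_def)
qed

section \<open>Non-isomorphism of the even and the odd model\<close>

lemma parity_models_not_isomorphic:
  assumes "\<nexists>\<phi>. thread D K \<phi>"
  shows "\<not> isomorphic binary_vocabulary (parity_model False) (parity_model True)"
proof
  assume "isomorphic binary_vocabulary (parity_model False) (parity_model True)"
  then obtain h where iso: "isomorphism binary_vocabulary (parity_model False) (parity_model True) h"
    by (auto simp: isomorphic_def)
  have maps: "h x \<in> enc ` pts" if "x \<in> enc ` pts" for x
    using iso that by (auto simp: isomorphism_def bij_betw_def)
  have pres: "[h x, h y] \<in> rel_of (parity_model True) R"
    if "[x, y] \<in> rel_of (parity_model False) R" "x \<in> enc ` pts" "y \<in> enc ` pts" for x y R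
    using iso that by (auto simp: isomorphism_def binary_vocabulary_def tuples_2)
  define q where "q a = dec (h (enc (a, {})))" for a
  define g where "g a = snd (q a)" for a
  have q: "q a \<in> pts" "h (enc (a, {})) = enc (q a)" if "a \<subseteq> D" "countable a" for a
    using maps[of "enc (a, {})"] fibre_empty[OF that] by (auto simp: q_def)
  \<comment> \<open>The empty sets project to each other, and the isomorphism carries this over to
    their images.\<close>
  have hp: "[enc (q a), enc (q b)] \<in> rel_of (parity_model True) {enc (b, {})}"
    if "a \<subseteq> D" "countable a" "b \<subseteq> a" for a b
  proof -
    have b: "b \<subseteq> D" "countable b" using that countable_subset by blast+
    have "[enc (a, {}), enc (b, {})] \<in> rel_of (parity_model False) {enc (b, {})}"
      using fibre_empty that b by (simp add: proj_rel_iff)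
    from pres[OF this] show ?thesis
      using fibre_empty that b q by auto
  qed
  \<comment> \<open>In the case \<open>b = a\<close> the symbol names the fibre of \<open>a\<close>,
    while the relation forces it to name the fibre of the image; so the isomorphism keeps the
    fibre.\<close>
  have fst_q: "fst (q a) = a" if "a \<subseteq> D" "countable a" for a
  proof -
    have "{enc (a, {})} = {enc (fst (q a), {})}"
      using hp[OF that subset_refl] q(1)[OF that] by (subst (asm) proj_rel_iff) auto
    moreover have "(fst (q a), {}) \<in> pts"
      using q(1)[OF that] by (intro fibre_empty) (auto simp: fibre_points_def)
    ultimately show ?thesis using fibre_empty[OF that] by (auto simp: enc_eq_iff)
  qed
  have qg: "(a, g a) \<in> pts" "q a = (a, g a)" if "a \<subseteq> D" "countable a" for a
    using q(1)[OF that] fst_q[OF that] by (metis g_def prod.collapse)+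
  have par: "g a \<subseteq> K \<and> odd (card (g a))" if "a \<subseteq> D" "countable a" for a
  proof -
    have "[enc (a, {}), enc (a, {})] \<in> rel_of (parity_model False) {}"
      using fibre_empty[OF that] by (simp add: parity_rel_iff)
    from pres[OF this] have "[enc (q a), enc (q a)] \<in> rel_of (parity_model True) {}"
      using fibre_empty[OF that] q(2)[OF that] by auto
    thus ?thesis using q(1)[OF that] by (simp add: parity_rel_iff g_def)
  qed
  have "\<exists>\<phi>. thread D K \<phi>"
  proof (rule thread_of_coherent_odd_system[of D g K])
    fix a b assume ab: "a \<subseteq> D" "countable a" "b \<subseteq> a"
    have "b \<subseteq> D" "countable b" using ab countable_subset by blast+
    thus "g b = proj b (g a)"
      using hp[OF ab] q(1) ab qg(2) by (subst (asm) proj_rel_iff) auto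
  qed (use par qg in \<open>auto simp: fibre_points_def\<close>)
  thus False using assms by blast
qed

section \<open>Partial isomorphisms from partial threads\<close>

definition partial_thread :: "('d \<rightharpoonup> 'e) \<Rightarrow> bool" where
  "partial_thread \<psi> \<longleftrightarrow> dom \<psi> \<subseteq> D \<and> ran \<psi> \<subseteq> E \<and>
     (\<forall>a. a \<subseteq> dom \<psi> \<and> countable a \<longrightarrow> \<psi> |` a \<in> K)"

text \<open>On each fibre over a subset of \<open>dom \<psi>\<close> this adds the basis vector
  obtained by restricting \<psi>.\<close>

definition translation :: "('d \<rightharpoonup> 'e) \<Rightarrow> 'a \<rightharpoonup> 'a" where
  "translation \<psi> x =
     (if x \<in> enc ` pts \<and> fst (dec x) \<subseteq> dom \<psi>
      then Some (enc (fst (dec x), toggle (\<psi> |` fst (dec x)) (snd (dec x)))) else None)"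

lemma translation_enc:
  "(a, S) \<in> pts \<Longrightarrow>
     translation \<psi> (enc (a, S)) = (if a \<subseteq> dom \<psi> then Some (enc (a, toggle (\<psi> |` a) S)) else None)"
  by (simp add: translation_def)

lemma dom_translation: "dom (translation \<psi>) = {enc (a, S) | a S. (a, S) \<in> pts \<and> a \<subseteq> dom \<psi>}"
  by (auto simp: translation_def dom_def) force+

lemma translation_mono:
  assumes "\<psi> \<subseteq>\<^sub>m \<psi>'"
  shows "translation \<psi> \<subseteq>\<^sub>m translation \<psi>'"
  unfolding map_le_def
proof
  fix x assume "x \<in> dom (translation \<psi>)"
  then obtain a S where x: "x = enc (a, S)" "(a, S) \<in> pts" "a \<subseteq> dom \<psi>"
    by (auto simp: dom_translation)
  have "\<psi> |` a = \<psi>' |` a"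
    by (rule ext) (use assms x(3) in \<open>auto simp: map_le_def restrict_map_def\<close>)
  moreover have "a \<subseteq> dom \<psi>'" using x(3) assms map_le_implies_dom_le by blast
  ultimately show "translation \<psi> x = translation \<psi>' x" using x by (simp add: translation_enc)
qed

lemma toggle_restrict_fibre:
  assumes "partial_thread \<psi>" "(a, S) \<in> pts" "a \<subseteq> dom \<psi>"
  shows "(a, toggle (\<psi> |` a) S) \<in> pts"
proof (rule toggle_fibre_points[OF assms(2)])
  show "dom (\<psi> |` a) = a" using assms(3) by auto
  show "ran (\<psi> |` a) \<subseteq> E" using assms(1) by (auto simp: partial_thread_def ran_def restrict_map_def)
qed

text \<open>Toggling is an involution, so the same translation supplies a preimage.\<close>

lemma ran_translation:
  assumes "partial_thread \<psi>" "(a, S) \<in> pts" "a \<subseteq> dom \<psi>"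
  shows "enc (a, S) \<in> ran (translation \<psi>)"
proof (rule ranI)
  show "translation \<psi> (enc (a, toggle (\<psi> |` a) S)) = Some (enc (a, S))"
    using toggle_restrict_fibre[OF assms] assms(3) by (simp add: translation_enc)
qed

text \<open>Toggling an element of \<open>K\<close> flips the parity and keeps the truth of
  inclusion in \<open>K\<close>, so even good sets correspond to odd ones. Projections are respected
  because the restrictions of \<psi> are coherent and \<open>proj\<close> is additive.\<close>

lemma partial_iso_translation:
  assumes "partial_thread \<psi>"
  shows "partial_iso binary_vocabulary (parity_model False) (parity_model True) (translation \<psi>)"
  unfolding partial_iso_binary_iff
proof (intro conjI allI ballI)
  let ?p = "translation \<psi>"
  show "dom ?p \<subseteq> univ (parity_model False)" by (auto simp: dom_translation)
  show "ran ?p \<subseteq> univ (parity_model True)"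
  proof
    fix y assume "y \<in> ran ?p"
    then obtain x where x: "?p x = Some y" by (auto simp: ran_def)
    then obtain a S where "x = enc (a, S)" "(a, S) \<in> pts" "a \<subseteq> dom \<psi>"
      using dom_translation[of \<psi>] by blast
    thus "y \<in> univ (parity_model True)"
      using x toggle_restrict_fibre[OF assms] by (auto simp: translation_enc)
  qed
  show "inj_on ?p (dom ?p)"
  proof (rule inj_onI)
    fix x y assume "x \<in> dom ?p" "y \<in> dom ?p" and eq: "?p x = ?p y"
    then obtain a S b T where x: "x = enc (a, S)" "(a, S) \<in> pts" "a \<subseteq> dom \<psi>"
      and y: "y = enc (b, T)" "(b, T) \<in> pts" "b \<subseteq> dom \<psi>"
      by (auto simp: dom_translation)
    have "(a, toggle (\<psi> |` a) S) = (b, toggle (\<psi> |` b) T)"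
      using eq x y toggle_restrict_fibre[OF assms] by (auto simp: translation_enc enc_eq_iff)
    thus "x = y" using x(1) y(1) toggle_toggle by (metis prod.inject)
  qed
  fix R x y assume "x \<in> dom ?p" "y \<in> dom ?p"
  then obtain a S b T where x: "x = enc (a, S)" "(a, S) \<in> pts" "a \<subseteq> dom \<psi>"
    and y: "y = enc (b, T)" "(b, T) \<in> pts" "b \<subseteq> dom \<psi>"
    by (auto simp: dom_translation)
  let ?S = "toggle (\<psi> |` a) S" and ?T = "toggle (\<psi> |` b) T"
  have px: "the (?p (enc (a, S))) = enc (a, ?S)" "(a, ?S) \<in> pts"
    and py: "the (?p (enc (b, T))) = enc (b, ?T)" "(b, ?T) \<in> pts"
    using x y toggle_restrict_fibre[OF assms] by (auto simp: translation_enc)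
  have fin: "finite S" "countable a" using x(2) by (auto simp: fibre_points_def)
  show "[x, y] \<in> rel_of (parity_model False) R \<longleftrightarrow>
    [the (?p x), the (?p y)] \<in> rel_of (parity_model True) R"
  proof (cases "R = {}")
    case True
    have "\<psi> |` a \<in> K" using assms x(3) fin(2) by (auto simp: partial_thread_def)
    hence "?S \<subseteq> K \<longleftrightarrow> S \<subseteq> K" by (rule toggle_subset_iff)
    moreover have "(a, ?S) = (b, ?T) \<longleftrightarrow> (a, S) = (b, T)"
      by (metis prod.inject toggle_toggle)
    moreover have "odd (card ?S) \<longleftrightarrow> even (card S)" using fin(1) by (rule odd_card_toggle)
    ultimately show ?thesis
      unfolding px(1) py(1) x(1) y(1) True parity_rel_iff[OF px(2) py(2)] parity_rel_iff[OF x(2) y(2)]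
      by simp
  next
    case False
    have "?T = proj b ?S \<longleftrightarrow> T = proj b S" if "b \<subseteq> a"
    proof -
      have "(\<psi> |` a) |` b = \<psi> |` b" using that by (simp add: Int_absorb1)
      hence "proj b ?S = toggle (\<psi> |` b) (proj b S)" by (simp add: proj_toggle fin)
      thus ?thesis by (metis toggle_toggle)
    qed
    thus ?thesis
      unfolding px(1) py(1) x(1) y(1) proj_rel_iff[OF px(2) py(2) False] proj_rel_iff[OF x(2) y(2) False]
      by auto
  qed
qed

end


section \<open>Threads and total functions\<close>

text \<open>At \<open>(i, x)\<close> a thread takes a value \<open>(t, n, v)\<close>, where \<open>(t, n)\<close> depends on \<open>i\<close> only,
  injectively. If \<open>x\<close> is at most \<open>t\<close>, then \<open>v\<close> is the value at \<open>x\<close> of a fixed element of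
  \<open>F\<close>; otherwise \<open>v\<close> is arbitrary.\<close>

definition local_threads ::
    "'a rel \<Rightarrow> ('a \<rightharpoonup> 'a) set \<Rightarrow> ('a \<times> 'a \<rightharpoonup> 'a \<times> nat \<times> 'a) set" where
  "local_threads lam F = {c.
     (\<forall>i x t n v. c (i, x) = Some (t, n, v) \<longrightarrow> t \<in> Field lam) \<and>
     (\<forall>i x t n v i' x' t' n' v'. c (i, x) = Some (t, n, v) \<longrightarrow> c (i', x') = Some (t', n', v') \<longrightarrow>
        (i = i' \<longleftrightarrow> t = t' \<and> n = n')) \<and>
     (\<exists>f\<in>F. \<forall>i x t n v. c (i, x) = Some (t, n, v) \<longrightarrow> (x, t) \<in> lam \<longrightarrow> f x = Some v)}"

lemma local_threadsD:
  assumes "c \<in> local_threads lam F" "c (i, x) = Some (t, n, v)"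
  shows "t \<in> Field lam"
    and "c (i', x') = Some (t', n', v') \<Longrightarrow> i = i' \<longleftrightarrow> t = t' \<and> n = n'"
  using assms unfolding local_threads_def mem_Collect_eq by metis+

text \<open>This counts the labels \<open>(t, n)\<close> with \<open>t\<close> below a fixed point.
  If there are finitely many such \<open>t\<close>, the bound comes from \<open>natLeq <o r\<close>;
  otherwise the factor of the natural numbers is absorbed.\<close>

lemma card_of_underS_times_nat:
  assumes "Card_order r" "natLeq <o r" "a \<in> Field r"
  shows "|underS r a \<times> (UNIV :: nat set)| <o r"
proof (cases "finite (underS r a)")
  case True
  hence "countable (underS r a \<times> (UNIV :: nat set))"
    by (intro countable_SIGMA) (auto intro: countable_finite)
  thus ?thesis
    using assms(2) ordLeq_ordLess_trans by (auto simp: countable_card_le_natLeq)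
next
  case False
  hence "|underS r a \<times> (UNIV :: nat set)| =o |underS r a|"
    by (intro card_of_Times_infinite_simps) (auto simp: infinite_iff_card_of_nat)
  thus ?thesis using card_of_underS[OF assms(1,3)] ordIso_ordLess_trans by blast
qed

text \<open>Injectivity of the labels makes the points \<open>\<tau> i\<close> unbounded, so each
  \<open>x\<close> has a row \<open>I x\<close> revealing a value at \<open>x\<close>. These values
  form a total function, each countable part of which agrees with a member of \<open>F\<close>;
  locality puts it into \<open>F\<close>.\<close>

lemma no_thread_local_threads:
  fixes lam :: "'a rel" and F :: "('a \<rightharpoonup> 'a) set"
  assumes lam: "Card_order lam" "natLeq <o lam"
    and F: "F \<subseteq> {f. dom f \<subseteq> Field lam \<and> ran f \<subseteq> Field lam}"
    and loc: "\<And>f. dom f \<subseteq> Field lam \<Longrightarrow> ran f \<subseteq> Field lam \<Longrightarrow>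
           f \<in> F \<longleftrightarrow> (\<forall>u. u \<subseteq> dom f \<and> countable u \<longrightarrow> f |` u \<in> F)"
    and total: "\<not> (\<exists>f\<in>F. dom f = Field lam)"
  shows "\<not> thread (Field lam \<times> Field lam) (local_threads lam F) \<phi>"
proof
  assume "thread (Field lam \<times> Field lam) (local_threads lam F) \<phi>"
  hence approx: "\<exists>c\<in>local_threads lam F. \<forall>d\<in>a. c d = Some (\<phi> d)"
    if "a \<subseteq> Field lam \<times> Field lam" "countable a" for a
    using that by (simp add: thread_def)
  have wo: "wo_rel lam" using lam(1) by (simp add: card_order_on_well_order_on wo_rel_def)
  define \<tau> where "\<tau> i = fst (\<phi> (i, i))" for i
  define \<nu> where "\<nu> i = fst (snd (\<phi> (i, i)))" for i
  define val where "val i x = snd (snd (\<phi> (i, x)))" for i x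
  have \<phi>_diag: "\<phi> (i, i) = (\<tau> i, \<nu> i, val i i)" for i
    by (simp add: \<tau>_def \<nu>_def val_def)
  \<comment> \<open>Entries of one row share their label, so the label can be read on the
    diagonal.\<close>
  have \<phi>: "\<phi> (i, x) = (\<tau> i, \<nu> i, val i x)" if ix: "i \<in> Field lam" "x \<in> Field lam" for i x
  proof -
    obtain c where c: "c \<in> local_threads lam F" "c (i, x) = Some (\<phi> (i, x))"
      "c (i, i) = Some (\<tau> i, \<nu> i, val i i)"
      using approx[of "{(i, x), (i, i)}"] ix \<phi>_diag by auto
    obtain t n v where tnv: "\<phi> (i, x) = (t, n, v)" by (metis surj_pair)
    show ?thesis
      using local_threadsD(2)[OF c(1), of i x t n v i i "\<tau> i" "\<nu> i" "val i i"] c(2,3) tnv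
      by (simp add: val_def)
  qed
  have \<tau>: "\<tau> i \<in> Field lam" if i: "i \<in> Field lam" for i
  proof -
    obtain c where "c \<in> local_threads lam F" "c (i, i) = Some (\<tau> i, \<nu> i, val i i)"
      using approx[of "{(i, i)}"] i \<phi>_diag by auto
    thus ?thesis by (rule local_threadsD(1))
  qed
  have inj: "i = j" if ij: "i \<in> Field lam" "j \<in> Field lam" and eq: "\<tau> i = \<tau> j" "\<nu> i = \<nu> j" for i j
  proof -
    obtain c where "c \<in> local_threads lam F" "c (i, i) = Some (\<tau> i, \<nu> i, val i i)"
      "c (j, j) = Some (\<tau> j, \<nu> j, val j j)"
      using approx[of "{(i, i), (j, j)}"] ij \<phi>_diag by auto
    thus ?thesis using local_threadsD(2) eq by metis
  qed
  have "\<exists>i\<in>Field lam. (x, \<tau> i) \<in> lam" if x: "x \<in> Field lam" for x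
  proof (rule ccontr)
    assume no: "\<not> ?thesis"
    have "\<tau> i \<in> underS lam x" if i: "i \<in> Field lam" for i
    proof -
      have "(x, \<tau> i) \<notin> lam" using no i by blast
      moreover from this have "(\<tau> i, x) \<in> lam" using wo_rel.TOTALS[OF wo] x \<tau>[OF i] by blast
      ultimately show ?thesis by (auto simp: underS_def)
    qed
    \<comment> \<open>Pigeonhole: the labels would inject \<open>lam\<close> many rows into fewer
      than \<open>lam\<close> pairs.\<close>
    hence "|Field lam| \<le>o |underS lam x \<times> (UNIV :: nat set)|"
      by (intro card_of_ordLeqI[of "\<lambda>i. (\<tau> i, \<nu> i)"]) (auto simp: inj_on_def intro: inj)
    hence "|Field lam| <o lam"
      using card_of_underS_times_nat[OF lam x] ordLeq_ordLess_trans by blast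
    thus False using card_of_Field_ordIso[OF lam(1)] not_ordLess_ordIso by blast
  qed
  then obtain I where I: "\<And>x. x \<in> Field lam \<Longrightarrow> I x \<in> Field lam"
    "\<And>x. x \<in> Field lam \<Longrightarrow> (x, \<tau> (I x)) \<in> lam" by metis
  define f where "f x = (if x \<in> Field lam then Some (val (I x) x) else None)" for x
  have dom_f: "dom f = Field lam" by (auto simp: f_def split: if_splits)
  \<comment> \<open>A single local thread covers the countably many entries \<open>(I x, x)\<close>,
    and its one witness in \<open>F\<close> serves all rows simultaneously.\<close>
  have cover: "\<exists>g\<in>F. \<forall>x\<in>u. g x = f x" if u: "u \<subseteq> Field lam" "countable u" for u
  proof -
    have "(\<lambda>x. (I x, x)) ` u \<subseteq> Field lam \<times> Field lam" using u(1) I(1) by auto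
    then obtain c where c: "c \<in> local_threads lam F"
      "\<And>x. x \<in> u \<Longrightarrow> c (I x, x) = Some (\<phi> (I x, x))"
      using approx[of "(\<lambda>x. (I x, x)) ` u"] u(2) by auto
    obtain g where g: "g \<in> F"
      "\<And>i x t n v. c (i, x) = Some (t, n, v) \<Longrightarrow> (x, t) \<in> lam \<Longrightarrow> g x = Some v"
      using c(1) unfolding local_threads_def mem_Collect_eq by metis
    have "g x = f x" if "x \<in> u" for x
    proof -
      have x: "x \<in> Field lam" using that u(1) by blast
      have "g x = Some (val (I x) x)"
        using g(2) c(2)[OF that] \<phi>[OF I(1)[OF x] x] I(2)[OF x] by metis
      thus ?thesis using x by (simp add: f_def)
    qed
    thus ?thesis using g(1) by blast
  qed
  have ran_f: "ran f \<subseteq> Field lam"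
  proof
    fix y assume "y \<in> ran f"
    then obtain x where x: "f x = Some y" by (auto simp: ran_def)
    hence "x \<in> Field lam" using dom_f by blast
    then obtain g where "g \<in> F" "g x = Some y" using cover[of "{x}"] x by auto
    thus "y \<in> Field lam" using F by (auto simp: ran_def)
  qed
  have "f |` u \<in> F" if u: "u \<subseteq> dom f" "countable u" for u
  proof -
    obtain g where g: "g \<in> F" "\<forall>x\<in>u. g x = f x"
      using cover[OF u(1)[unfolded dom_f] u(2)] by blast
    have "f |` u = g |` u" by (rule ext) (use g(2) in \<open>simp add: restrict_map_def\<close>)
    moreover have "u \<subseteq> dom g" using g(2) u(1) by (auto simp: dom_def)
    ultimately show ?thesis using loc[of g] g(1) F u(2) by auto
  qed
  hence "f \<in> F" using loc[of f] dom_f ran_f by auto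
  thus False using total dom_f by blast
qed

section \<open>The thread of a play\<close>

text \<open>\<open>W \<beta>\<close> is the set of first coordinates asked for at stage \<open>\<beta>\<close> and \<open>z \<beta>\<close> is the node
  chosen there. A coordinate \<open>i\<close> first asked for at stage \<open>\<beta>\<close> is stamped with a point that is
  new in the domain of \<open>z \<beta>\<close> and with its position in \<open>W \<beta>\<close>; hence the stamps are distinct.\<close>

definition born :: "'i rel \<Rightarrow> ('i \<Rightarrow> 'a set) \<Rightarrow> 'i \<Rightarrow> 'a \<Rightarrow> 'i \<Rightarrow> bool" where
  "born s W \<alpha> i \<beta> \<longleftrightarrow> \<beta> \<in> under s \<alpha> \<and> i \<in> W \<beta> \<and> (\<forall>\<gamma>\<in>underS s \<beta>. i \<notin> W \<gamma>)"

definition new_point :: "'i rel \<Rightarrow> ('i \<Rightarrow> 'a \<rightharpoonup> 'a) \<Rightarrow> 'i \<Rightarrow> 'a" where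
  "new_point s z \<beta> = (SOME t. t \<in> dom (z \<beta>) \<and> (\<forall>\<gamma>\<in>underS s \<beta>. t \<notin> dom (z \<gamma>)))"

text \<open>Beyond the new point the last component is unconstrained. The new point itself serves as
  filler, since it lies in \<open>Field lam\<close> and keeps the values in the required
  range.\<close>

definition stamp ::
    "'a rel \<Rightarrow> 'i rel \<Rightarrow> ('i \<Rightarrow> 'a \<rightharpoonup> 'a) \<Rightarrow> ('i \<Rightarrow> 'a set) \<Rightarrow> 'i \<Rightarrow> 'a \<times> 'a \<Rightarrow> 'a \<times> nat \<times> 'a" where
  "stamp lam s z W \<beta> = (\<lambda>(i, x). (new_point s z \<beta>, to_nat_on (W \<beta>) i,
     if (x, new_point s z \<beta>) \<in> lam then the (z \<beta> x) else new_point s z \<beta>))"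

definition play_thread ::
    "'a rel \<Rightarrow> 'i rel \<Rightarrow> ('i \<Rightarrow> 'a \<rightharpoonup> 'a) \<Rightarrow> ('i \<Rightarrow> 'a set) \<Rightarrow> 'i \<Rightarrow> 'a \<times> 'a \<rightharpoonup> 'a \<times> nat \<times> 'a" where
  "play_thread lam s z W \<alpha> = (\<lambda>(i, x).
     if x \<in> Field lam \<and> (\<exists>\<beta>. born s W \<alpha> i \<beta>)
     then Some (stamp lam s z W (SOME \<beta>. born s W \<alpha> i \<beta>) (i, x)) else None)"

text \<open>A strategy sees the play only up to the current stage; by this lemma the truncated
  history determines the same thread as the whole play.\<close>

lemma play_thread_cong:
  assumes "trans s" and eq: "\<And>\<beta>. \<beta> \<in> under s \<alpha> \<Longrightarrow> z \<beta> = z' \<beta> \<and> W \<beta> = W' \<beta>"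
  shows "play_thread lam s z W \<alpha> = play_thread lam s z' W' \<alpha>"
proof -
  have sub: "\<gamma> \<in> under s \<alpha>" if "\<beta> \<in> under s \<alpha>" "\<gamma> \<in> underS s \<beta>" for \<beta> \<gamma>
    using that assms(1) by (auto simp: under_def underS_def dest: transD)
  have born: "born s W \<alpha> i = born s W' \<alpha> i" for i
    by (rule ext) (use eq sub in \<open>unfold born_def, metis\<close>)
  have "new_point s z \<beta> = new_point s z' \<beta>" if "\<beta> \<in> under s \<alpha>" for \<beta>
  proof -
    have "(\<forall>\<gamma>\<in>underS s \<beta>. t \<notin> dom (z \<gamma>)) \<longleftrightarrow> (\<forall>\<gamma>\<in>underS s \<beta>. t \<notin> dom (z' \<gamma>))" for t
      by (intro ball_cong refl) (use eq[OF sub[OF that]] in simp)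
    thus ?thesis using eq[OF that] by (simp add: new_point_def)
  qed
  hence stamp: "stamp lam s z W \<beta> = stamp lam s z' W' \<beta>" if "\<beta> \<in> under s \<alpha>" for \<beta>
    using eq[OF that] that by (simp add: stamp_def cong: if_cong)
  show ?thesis
  proof (rule ext, clarify)
    fix i x
    show "play_thread lam s z W \<alpha> (i, x) = play_thread lam s z' W' \<alpha> (i, x)"
    proof (cases "\<exists>\<beta>. born s W' \<alpha> i \<beta>")
      case True
      hence "born s W' \<alpha> i (SOME \<beta>. born s W' \<alpha> i \<beta>)" by (rule someI_ex)
      hence "(SOME \<beta>. born s W' \<alpha> i \<beta>) \<in> under s \<alpha>"
        by (rule born_def[THEN iffD1, THEN conjunct1])
      from stamp[OF this] show ?thesis by (simp add: play_thread_def born)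
    next
      case False
      thus ?thesis by (auto simp: play_thread_def born)
    qed
  qed
qed

text \<open>The condition \<open>new\<close> is restricted to stages with
  \<open>W \<beta> \<noteq> {}\<close>: at a limit stage the node may be just the union of the
  earlier ones, but there AIS requests nothing.\<close>

locale play =
  fixes lam :: "'a rel" and F :: "('a \<rightharpoonup> 'a) set"
    and s :: "'i rel" and z :: "'i \<Rightarrow> 'a \<rightharpoonup> 'a" and W :: "'i \<Rightarrow> 'a set" and \<alpha> :: 'i
  assumes F: "F \<subseteq> {f. dom f \<subseteq> Field lam \<and> ran f \<subseteq> Field lam}"
    and wo_s: "wo_rel s"
    and in_field: "\<alpha> \<in> Field s"
    and node: "\<beta> \<in> under s \<alpha> \<Longrightarrow> z \<beta> \<in> tree_nodes lam F"
    and mono: "\<beta> \<in> under s \<alpha> \<Longrightarrow> \<gamma> \<in> underS s \<beta> \<Longrightarrow> z \<gamma> \<subseteq>\<^sub>m z \<beta>"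
    and new: "\<beta> \<in> under s \<alpha> \<Longrightarrow> W \<beta> \<noteq> {} \<Longrightarrow>
          \<exists>t\<in>dom (z \<beta>). \<forall>\<gamma>\<in>underS s \<beta>. t \<notin> dom (z \<gamma>)"
    and countable_W: "\<beta> \<in> under s \<alpha> \<Longrightarrow> countable (W \<beta>)"
    and W_Field: "\<beta> \<in> under s \<alpha> \<Longrightarrow> W \<beta> \<subseteq> Field lam"
begin

abbreviation "\<psi> \<equiv> play_thread lam s z W"

lemma under_trans: "\<beta> \<in> under s \<gamma> \<Longrightarrow> \<gamma> \<in> under s \<delta> \<Longrightarrow> \<beta> \<in> under s \<delta>"
  using wo_rel.TRANS[OF wo_s] by (auto simp: under_def dest: transD)

lemma underS_under: "\<beta> \<in> underS s \<gamma> \<Longrightarrow> \<beta> \<in> under s \<gamma>"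
  by (simp add: underS_def under_def)

lemma under_cases:
  assumes "\<beta> \<in> under s \<alpha>" "\<gamma> \<in> under s \<alpha>"
  obtains "\<beta> = \<gamma>" | "\<beta> \<in> underS s \<gamma>" | "\<gamma> \<in> underS s \<beta>"
proof -
  have "\<beta> \<in> Field s" "\<gamma> \<in> Field s" using assms by (auto simp: under_def Field_def)
  thus ?thesis using that wo_rel.TOTALS[OF wo_s] by (auto simp: underS_def)
qed

lemma under_refl: "\<alpha> \<in> under s \<alpha>"
  using wo_rel.REFL[OF wo_s] in_field by (auto simp: under_def refl_on_def)

lemma play_under:
  assumes "\<delta> \<in> under s \<alpha>"
  shows "play lam F s z W \<delta>"
proof (rule play.intro)
  show "\<delta> \<in> Field s" using assms by (auto simp: under_def Field_def)
qed (use F wo_s node mono new countable_W W_Field under_trans[OF _ assms] in auto)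

lemma born_unique: "born s W \<alpha> i \<beta> \<Longrightarrow> born s W \<alpha> i \<gamma> \<Longrightarrow> \<beta> = \<gamma>"
  unfolding born_def by (metis under_cases)

lemma ex_born:
  assumes "\<beta> \<in> under s \<alpha>" "i \<in> W \<beta>"
  shows "\<exists>\<gamma>. born s W \<alpha> i \<gamma>"
proof -
  let ?B = "{\<beta> \<in> under s \<alpha>. i \<in> W \<beta>}"
  have B: "?B \<subseteq> Field s" "?B \<noteq> {}" using assms by (auto simp: under_def Field_def)
  let ?m = "wo_rel.minim s ?B"
  have m: "?m \<in> ?B" using wo_rel.minim_in[OF wo_s B] .
  have "i \<notin> W \<gamma>" if \<gamma>: "\<gamma> \<in> underS s ?m" for \<gamma>
  proof
    assume "i \<in> W \<gamma>"
    hence "\<gamma> \<in> ?B" using \<gamma> m under_trans underS_under by blast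
    hence "(?m, \<gamma>) \<in> s" using wo_rel.minim_least[OF wo_s B(1)] by blast
    thus False using \<gamma> wo_rel.ANTISYM[OF wo_s] by (auto simp: underS_def dest: antisymD)
  qed
  thus ?thesis using m by (auto simp: born_def)
qed

lemma play_thread_born:
  assumes "born s W \<alpha> i \<beta>" "x \<in> Field lam"
  shows "\<psi> \<alpha> (i, x) = Some (stamp lam s z W \<beta> (i, x))"
proof -
  have "(SOME \<beta>. born s W \<alpha> i \<beta>) = \<beta>"
    using assms(1) born_unique by (intro some_equality) auto
  thus ?thesis using assms by (auto simp: play_thread_def)
qed

lemma play_thread_SomeD:
  assumes "\<psi> \<alpha> (i, x) = Some y"
  obtains \<beta> where "born s W \<alpha> i \<beta>" "x \<in> Field lam" "y = stamp lam s z W \<beta> (i, x)"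
proof -
  obtain \<beta> where "born s W \<alpha> i \<beta>" "x \<in> Field lam"
    using assms by (auto simp: play_thread_def split: if_splits)
  thus thesis using that assms play_thread_born by simp
qed

lemma dom_play_thread:
  "dom (\<psi> \<alpha>) = (\<Union>\<beta>\<in>under s \<alpha>. W \<beta>) \<times> Field lam"
proof -
  have "(i, x) \<in> dom (\<psi> \<alpha>) \<longleftrightarrow> (\<exists>\<beta>\<in>under s \<alpha>. i \<in> W \<beta>) \<and> x \<in> Field lam" for i x
  proof
    assume "(i, x) \<in> dom (\<psi> \<alpha>)"
    thus "(\<exists>\<beta>\<in>under s \<alpha>. i \<in> W \<beta>) \<and> x \<in> Field lam"
      by (auto elim!: play_thread_SomeD simp: born_def)
  next
    assume "(\<exists>\<beta>\<in>under s \<alpha>. i \<in> W \<beta>) \<and> x \<in> Field lam"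
    thus "(i, x) \<in> dom (\<psi> \<alpha>)" using ex_born play_thread_born by blast
  qed
  thus ?thesis by (intro set_eqI) (auto simp only: split_paired_all mem_Sigma_iff UN_iff)
qed

text \<open>The stage at which a row is born is fixed once it has occurred, so later stages never
  revise a stamp.\<close>

lemma play_thread_mono:
  assumes "\<delta> \<in> under s \<alpha>"
  shows "\<psi> \<delta> \<subseteq>\<^sub>m \<psi> \<alpha>"
  unfolding map_le_def
proof
  fix d assume "d \<in> dom (\<psi> \<delta>)"
  then obtain i x y where d: "d = (i, x)" "\<psi> \<delta> (i, x) = Some y" by (cases d) auto
  obtain \<beta> where \<beta>: "born s W \<delta> i \<beta>" "x \<in> Field lam" "y = stamp lam s z W \<beta> (i, x)"
    using play.play_thread_SomeD[OF play_under[OF assms] d(2)] .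
  have "born s W \<alpha> i \<beta>" using \<beta>(1) under_trans[OF _ assms] by (auto simp: born_def)
  thus "\<psi> \<delta> d = \<psi> \<alpha> d" using play_thread_born \<beta>(2,3) d by simp
qed

lemma new_point:
  assumes "\<beta> \<in> under s \<alpha>" "W \<beta> \<noteq> {}"
  shows "new_point s z \<beta> \<in> dom (z \<beta>)" "\<gamma> \<in> underS s \<beta> \<Longrightarrow> new_point s z \<beta> \<notin> dom (z \<gamma>)"
proof -
  have "\<exists>t. t \<in> dom (z \<beta>) \<and> (\<forall>\<gamma>\<in>underS s \<beta>. t \<notin> dom (z \<gamma>))" using new[OF assms] by blast
  from someI_ex[OF this] show "new_point s z \<beta> \<in> dom (z \<beta>)"
    "\<gamma> \<in> underS s \<beta> \<Longrightarrow> new_point s z \<beta> \<notin> dom (z \<gamma>)"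
    by (auto simp: new_point_def)
qed

text \<open>If the stages differ, the new point of the later one lies outside the earlier node, so
  the points differ. Within one stage the enumeration of the countable set \<open>W \<beta>\<close>
  separates the rows.\<close>

lemma stamp_inj:
  assumes "born s W \<alpha> i \<beta>" "born s W \<alpha> j \<gamma>"
    and "new_point s z \<beta> = new_point s z \<gamma>" "to_nat_on (W \<beta>) i = to_nat_on (W \<gamma>) j"
  shows "i = j"
proof -
  have \<beta>: "\<beta> \<in> under s \<alpha>" "i \<in> W \<beta>" and \<gamma>: "\<gamma> \<in> under s \<alpha>" "j \<in> W \<gamma>"
    using assms(1,2) by (auto simp: born_def)
  have "new_point s z \<beta> \<in> dom (z \<beta>)" "new_point s z \<gamma> \<in> dom (z \<gamma>)"
    "\<beta> \<in> underS s \<gamma> \<Longrightarrow> new_point s z \<gamma> \<notin> dom (z \<beta>)"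
    "\<gamma> \<in> underS s \<beta> \<Longrightarrow> new_point s z \<beta> \<notin> dom (z \<gamma>)"
    using new_point \<beta> \<gamma> by blast+
  hence "\<beta> = \<gamma>" using assms(3) under_cases[OF \<beta>(1) \<gamma>(1)] by metis
  thus ?thesis
    using assms(4) \<beta> \<gamma>(2) inj_on_to_nat_on[OF countable_W[OF \<beta>(1)]] by (auto dest: inj_onD)
qed

text \<open>The domain of a node is an initial segment, so it contains everything below the new
  point; later nodes extend earlier ones.\<close>

lemma stamp_value:
  assumes "\<beta> \<in> under s \<alpha>" "W \<beta> \<noteq> {}" "(x, new_point s z \<beta>) \<in> lam"
  shows "z \<beta> x = Some (the (z \<beta> x))" "z \<alpha> x = z \<beta> x"
proof -
  have "x \<in> dom (z \<beta>)"
    using node[OF assms(1)] new_point(1)[OF assms(1,2)] assms(3)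
    by (auto simp: tree_nodes_def ofilter_def under_def)
  thus "z \<beta> x = Some (the (z \<beta> x))" by auto
  have "z \<beta> \<subseteq>\<^sub>m z \<alpha>"
    using mono[OF under_refl, of \<beta>] assms(1) by (cases "\<beta> = \<alpha>") (auto simp: underS_def under_def)
  thus "z \<alpha> x = z \<beta> x" using \<open>x \<in> dom (z \<beta>)\<close> by (simp add: map_le_def)
qed

lemma node_Field: "\<beta> \<in> under s \<alpha> \<Longrightarrow> dom (z \<beta>) \<subseteq> Field lam \<and> ran (z \<beta>) \<subseteq> Field lam"
  using subsetD[OF F] node by (fastforce simp: tree_nodes_def)

lemma ran_play_thread: "ran (\<psi> \<alpha>) \<subseteq> Field lam \<times> UNIV \<times> Field lam"
proof
  fix y assume "y \<in> ran (\<psi> \<alpha>)"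
  then obtain i x where "\<psi> \<alpha> (i, x) = Some y" by (auto simp: ran_def)
  then obtain \<beta> where \<beta>: "born s W \<alpha> i \<beta>" and y: "y = stamp lam s z W \<beta> (i, x)"
    by (rule play_thread_SomeD)
  have u: "\<beta> \<in> under s \<alpha>" "W \<beta> \<noteq> {}" using \<beta> by (auto simp: born_def)
  have "new_point s z \<beta> \<in> Field lam" using new_point(1)[OF u] node_Field[OF u(1)] by blast
  moreover have "the (z \<beta> x) \<in> Field lam" if "(x, new_point s z \<beta>) \<in> lam"
    using stamp_value(1)[OF u that] node_Field[OF u(1)] by (metis ranI subsetD)
  ultimately show "y \<in> Field lam \<times> UNIV \<times> Field lam" by (simp add: y stamp_def)
qed

text \<open>The current node \<open>z \<alpha>\<close> is the required member of \<open>F\<close>: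
  it extends all the nodes from which the revealed values were copied.\<close>

lemma restrict_play_thread_local: "\<psi> \<alpha> |` a \<in> local_threads lam F"
proof -
  have val: "\<exists>\<beta>. born s W \<alpha> i \<beta> \<and> t = new_point s z \<beta> \<and> n = to_nat_on (W \<beta>) i \<and>
      ((x, t) \<in> lam \<longrightarrow> z \<alpha> x = Some v)" if c: "(\<psi> \<alpha> |` a) (i, x) = Some (t, n, v)" for i x t n v
  proof -
    have "\<psi> \<alpha> (i, x) = Some (t, n, v)" using c by (auto simp: restrict_map_def split: if_splits)
    then obtain \<beta> where \<beta>: "born s W \<alpha> i \<beta>" and y: "(t, n, v) = stamp lam s z W \<beta> (i, x)"
      by (rule play_thread_SomeD)
    have u: "\<beta> \<in> under s \<alpha>" "W \<beta> \<noteq> {}" using \<beta> by (auto simp: born_def)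
    have tn: "t = new_point s z \<beta>" "n = to_nat_on (W \<beta>) i" using y by (simp_all add: stamp_def)
    have "z \<alpha> x = Some v" if "(x, t) \<in> lam"
      using stamp_value[OF u] that y tn(1) by (simp add: stamp_def)
    thus ?thesis using \<beta> tn by blast
  qed
  have "t \<in> Field lam" if c: "(\<psi> \<alpha> |` a) (i, x) = Some (t, n, v)" for i x t n v
  proof -
    obtain \<beta> where "born s W \<alpha> i \<beta>" "t = new_point s z \<beta>" using val[OF c] by blast
    thus ?thesis using new_point(1)[of \<beta>] node_Field[of \<beta>] by (auto simp: born_def)
  qed
  moreover have "i = j \<longleftrightarrow> t = t' \<and> n = n'"
    if c: "(\<psi> \<alpha> |` a) (i, x) = Some (t, n, v)" "(\<psi> \<alpha> |` a) (j, x') = Some (t', n', v')"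
    for i x t n v j x' t' n' v'
  proof -
    obtain \<beta> where \<beta>: "born s W \<alpha> i \<beta>" "t = new_point s z \<beta>" "n = to_nat_on (W \<beta>) i"
      using val[OF c(1)] by blast
    obtain \<gamma> where \<gamma>: "born s W \<alpha> j \<gamma>" "t' = new_point s z \<gamma>" "n' = to_nat_on (W \<gamma>) j"
      using val[OF c(2)] by blast
    show ?thesis using \<beta> \<gamma> born_unique stamp_inj by metis
  qed
  moreover have "z \<alpha> \<in> F" using node[OF under_refl] by (simp add: tree_nodes_def)
  moreover have "z \<alpha> x = Some v" if "(\<psi> \<alpha> |` a) (i, x) = Some (t, n, v)" "(x, t) \<in> lam" for i x t n v
    using val[OF that(1)] that(2) by blast
  ultimately show ?thesis
    unfolding local_threads_def mem_Collect_eq by (intro conjI bexI[of _ "z \<alpha>"]) blast+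
qed

end


section \<open>The game\<close>

lemma tree_ofD:
  assumes "(f, g) \<in> tree_of lam F" "f \<noteq> g"
  shows "f \<subseteq>\<^sub>m g" "\<exists>t\<in>dom g. t \<notin> dom f"
proof -
  show le: "f \<subseteq>\<^sub>m g" using assms(1) by (simp add: tree_of_def)
  show "\<exists>t\<in>dom g. t \<notin> dom f"
  proof (rule ccontr)
    assume "\<not> ?thesis"
    hence "dom g \<subseteq> dom f" by blast
    hence "g \<subseteq>\<^sub>m f" using le by (simp add: map_le_def subset_iff)
    thus False using le assms(2) map_le_antisym by blast
  qed
qed

text \<open>At a limit stage the union of the earlier translations may be a proper restriction of the
  translation by the union of the threads, because a countable set need not be contained in the
  domain of any earlier thread; so only the inclusion is invariant.\<close>

lemma EF_equivalent_parity_models: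
  fixes enc :: "('a \<times> 'a) set \<times> ('a \<times> 'a \<rightharpoonup> 'a \<times> nat \<times> 'a) set \<Rightarrow> 'a"
    and lam :: "'a rel" and F :: "('a \<rightharpoonup> 'a) set"
  defines "D \<equiv> Field lam \<times> Field lam" and "E \<equiv> Field lam \<times> (UNIV :: nat set) \<times> Field lam"
    and "K \<equiv> local_threads lam F"
  assumes inj: "inj_on enc (fibre_points D E)"
    and F: "F \<subseteq> {f. dom f \<subseteq> Field lam \<and> ran f \<subseteq> Field lam}"
  shows "EF_equivalent (tree_of lam F) cone binary_vocabulary
    (encoded_fibres.parity_model D E K enc False) (encoded_fibres.parity_model D E K enc True)"
proof -
  interpret encoded_fibres D E K enc using inj by unfold_locales
  let ?T = "tree_of lam F" and ?M = "parity_model False" and ?N = "parity_model True"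
  let ?s = "stages ?T"
  \<comment> \<open>These are the rows that meet the fibre index of some requested point.\<close>
  define W where "W A1 A2 \<beta> = (\<Union>x\<in>A1 \<beta> \<union> A2 \<beta>. fst ` fst (dec x))"
    for A1 A2 :: "('a \<rightharpoonup> 'a) set \<Rightarrow> 'a set" and \<beta>
  define \<sigma> where "\<sigma> \<alpha> z A1 A2 f = translation (play_thread lam ?s z (W A1 A2) \<alpha>)"
    for \<alpha> z A1 A2 and f :: "('a \<rightharpoonup> 'a) set \<Rightarrow> 'a \<rightharpoonup> 'a"
  have wo: "wo_rel ?s"
    by (simp add: wo_rel_def stages_def cardSuc_Card_order card_of_Card_order
        card_order_on_well_order_on)
  have "winning_ISO ?T cone binary_vocabulary ?M ?N \<sigma>"
    unfolding winning_ISO_def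
  proof (intro allI ballI impI)
    fix z A1 A2 f \<alpha>
    assume \<alpha>: "\<alpha> \<in> Field ?s"
      and hyp: "\<forall>\<beta>\<in>under ?s \<alpha>. legal_AIS ?T cone ?M ?N z A1 A2 \<beta> \<and> follows ?T \<sigma> z A1 A2 f \<beta>"
    let ?W = "W A1 A2"
    have node: "z \<beta> \<in> tree_nodes lam F" if "\<beta> \<in> under ?s \<alpha>" for \<beta>
      using hyp that by (auto simp: legal_AIS_def at_level_def Field_tree_of)
    have above: "(z \<gamma>, z \<beta>) \<in> ?T" "z \<gamma> \<noteq> z \<beta>" if "\<beta> \<in> under ?s \<alpha>" "\<gamma> \<in> underS ?s \<beta>" for \<beta> \<gamma>
      using hyp that by (auto simp: legal_AIS_def)
    have A: "A1 \<beta> \<subseteq> enc ` pts" "A2 \<beta> \<subseteq> enc ` pts" "countable (A1 \<beta> \<union> A2 \<beta>)"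
      if "\<beta> \<in> under ?s \<alpha>" for \<beta>
      using hyp that countable_if_ordLess_cone_csum_cone[of "A1 \<beta> \<union> A2 \<beta>"]
      by (auto simp: legal_AIS_def split: if_splits)
    have dec: "fst (dec x) \<subseteq> D" "countable (fst (dec x))" if "x \<in> enc ` pts" for x
      using that by (auto simp: fibre_points_def[of D E])
    interpret play lam F ?s z ?W \<alpha>
    proof (rule play.intro)
      fix \<beta> assume \<beta>: "\<beta> \<in> under ?s \<alpha>"
      show "countable (?W \<beta>)"
        using A[OF \<beta>] dec(2) unfolding W_def by (intro countable_UN countable_image) auto
      show "?W \<beta> \<subseteq> Field lam"
        using A(1,2)[OF \<beta>] dec(1) by (fastforce simp: W_def D_def)
      show "\<exists>t\<in>dom (z \<beta>). \<forall>\<gamma>\<in>underS ?s \<beta>. t \<notin> dom (z \<gamma>)" if "?W \<beta> \<noteq> {}"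
      proof -
        \<comment> \<open>A request occurs only at a successor stage. A point missing from the node
          of the preceding stage \<delta> is missing from all earlier nodes too, since domains
          increase.\<close>
        have "A1 \<beta> \<noteq> {} \<or> A2 \<beta> \<noteq> {}" using that by (auto simp: W_def)
        then obtain \<delta> where \<delta>: "succ_of ?s \<delta> \<beta>"
          using hyp \<beta> by (metis legal_AIS_def)
        hence \<delta>': "\<delta> \<in> Field ?s" "underS ?s \<beta> = under ?s \<delta>" by (auto simp: succ_of_def)
        have \<delta>S: "\<delta> \<in> underS ?s \<beta>"
          using \<delta>' wo_rel.REFL[OF wo] by (auto simp: under_def refl_on_def)
        have \<delta>\<alpha>: "\<delta> \<in> under ?s \<alpha>"
          using \<delta>S \<beta> wo_rel.TRANS[OF wo] by (auto simp: under_def underS_def dest: transD)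
        obtain t where t: "t \<in> dom (z \<beta>)" "t \<notin> dom (z \<delta>)"
          using tree_ofD(2)[OF above[OF \<beta> \<delta>S]] by blast
        have "dom (z \<gamma>) \<subseteq> dom (z \<delta>)" if "\<gamma> \<in> underS ?s \<beta>" for \<gamma>
        proof (cases "\<gamma> = \<delta>")
          case False
          hence "\<gamma> \<in> underS ?s \<delta>" using that \<delta>'(2) by (auto simp: under_def underS_def)
          thus ?thesis
            using tree_ofD(1)[OF above[OF \<delta>\<alpha>]] map_le_implies_dom_le by blast
        qed simp
        thus ?thesis using t by blast
      qed
    qed (use F wo \<alpha> node tree_ofD(1)[OF above] in auto)
    have succ: "f \<beta> = translation (\<psi> \<beta>)" if \<beta>: "\<beta> \<in> under ?s \<alpha>" and "succ_of ?s \<gamma> \<beta>" for \<beta> \<gamma>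
    proof -
      let ?z = "restrict z (under ?s \<beta>)"
      let ?W' = "W (restrict A1 (under ?s \<beta>)) (restrict A2 (under ?s \<beta>))"
      have "f \<beta> = translation (play_thread lam ?s ?z ?W' \<beta>)"
        using hyp \<beta> that(2) unfolding follows_def \<sigma>_def by blast
      also have "play_thread lam ?s ?z ?W' \<beta> = \<psi> \<beta>"
        using wo_rel.TRANS[OF wo] by (rule play_thread_cong) (simp add: W_def)
      finally show ?thesis .
    qed
    have le: "f \<beta> \<subseteq>\<^sub>m translation (\<psi> \<beta>)" if "\<beta> \<in> under ?s \<alpha>" for \<beta>
      using that
    proof (induction \<beta> rule: wo_rel.well_order_induct[OF wo])
      case (1 \<beta>)
      have fol: "follows ?T \<sigma> z A1 A2 f \<beta>" using hyp 1(2) by blast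
      have "\<beta> \<in> Field ?s" using 1(2) by (auto simp: under_def Field_def)
      then consider "is_zero ?s \<beta>" | \<gamma> where "succ_of ?s \<gamma> \<beta>" | "is_limit ?s \<beta>"
        by (auto simp: is_limit_def)
      thus ?case
      proof cases
        case 1
        thus ?thesis using fol by (simp add: follows_def)
      next
        case 2
        thus ?thesis using succ[OF 1(2)] by simp
      next
        case 3
        have eq: "Map.graph (f \<beta>) = (\<Union>\<gamma>\<in>underS ?s \<beta>. Map.graph (f \<gamma>))"
          using fol 3 by (simp add: follows_def)
        have "translation (\<psi> \<beta>) x = Some y" if xy: "f \<beta> x = Some y" for x y
        proof -
          obtain \<gamma> where \<gamma>: "\<gamma> \<in> underS ?s \<beta>" "f \<gamma> x = Some y"
            using in_graphI[of "f \<beta>", OF xy] unfolding eq by (auto dest: in_graphD)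
          have u: "\<gamma> \<in> under ?s \<beta>" "\<gamma> \<in> under ?s \<alpha>"
            using underS_under[OF \<gamma>(1)] under_trans 1(2) by blast+
          have "f \<gamma> \<subseteq>\<^sub>m translation (\<psi> \<gamma>)" using 1(1) \<gamma>(1) u(2) by (auto simp: underS_def)
          moreover have "translation (\<psi> \<gamma>) \<subseteq>\<^sub>m translation (\<psi> \<beta>)"
            using play.play_thread_mono[OF play_under[OF 1(2)] u(1)] by (rule translation_mono)
          ultimately have "f \<gamma> \<subseteq>\<^sub>m translation (\<psi> \<beta>)" by (rule map_le_trans)
          thus ?thesis using \<gamma>(2) by (metis domI map_le_def)
        qed
        thus ?thesis by (auto simp: map_le_def)
      qed
    qed
    have "dom (\<psi> \<alpha>) \<subseteq> D"
      unfolding dom_play_thread D_def using W_Field by (intro Sigma_mono UN_least) auto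
    hence pt: "partial_thread (\<psi> \<alpha>)"
      unfolding partial_thread_def unfolding E_def K_def
      using ran_play_thread restrict_play_thread_local by simp
    show "legal_ISO ?T binary_vocabulary ?M ?N A1 A2 f \<alpha>"
      unfolding legal_ISO_def
    proof (intro conjI allI impI)
      show "partial_iso binary_vocabulary ?M ?N (f \<alpha>)"
        using partial_iso_translation[OF pt] le[OF under_refl] by (rule partial_iso_binary_submap)
      fix \<beta> assume \<beta>: "succ_of ?s \<beta> \<alpha>"
      have f: "f \<alpha> = translation (\<psi> \<alpha>)" using succ[OF under_refl \<beta>] .
      have "\<beta> \<in> under ?s \<beta>" "underS ?s \<alpha> = under ?s \<beta>"
        using \<beta> wo_rel.REFL[OF wo] by (auto simp: succ_of_def under_def refl_on_def)
      hence u: "\<beta> \<in> under ?s \<alpha>" using underS_under by blast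
      show "f \<beta> \<subseteq>\<^sub>m f \<alpha>"
        unfolding f using le[OF u] translation_mono[OF play_thread_mono[OF u]] by (rule map_le_trans)
      \<comment> \<open>All rows meeting \<open>a\<close> are born by this stage, and a thread fills
        whole rows. Translations preserve fibres, so this settles requests on both sides.\<close>
      have cover: "\<exists>a S. x = enc (a, S) \<and> (a, S) \<in> pts \<and> a \<subseteq> dom (\<psi> \<alpha>)"
        if x: "x \<in> A1 \<alpha> \<union> A2 \<alpha>" for x
      proof -
        obtain a S where aS: "x = enc (a, S)" "(a, S) \<in> pts"
          using x A(1,2)[OF under_refl] by fastforce
        have "fst ` a \<subseteq> ?W \<alpha>" using x aS by (force simp: W_def)
        moreover have "a \<subseteq> D" using aS(2) by (simp add: fibre_points_def)
        ultimately have "a \<subseteq> dom (\<psi> \<alpha>)"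
          using under_refl unfolding dom_play_thread D_def by force
        thus ?thesis using aS by blast
      qed
      show "A1 \<alpha> \<subseteq> dom (f \<alpha>)"
        unfolding f dom_translation using cover by blast
      show "A2 \<alpha> \<subseteq> ran (f \<alpha>)"
        unfolding f using cover ran_translation[OF pt] by blast
    qed
  qed
  thus ?thesis by (auto simp: EF_equivalent_def)
qed

theorem theorem2p1:
  fixes lam :: "'a rel" and F :: "('a \<rightharpoonup> 'a) set"
  assumes "Card_order lam"
    and "cf lam <o lam"
    and "lam =o lam ^c natLeq"
    and "F \<subseteq> {f. dom f \<subseteq> Field lam \<and> ran f \<subseteq> Field lam}"
    and "\<And>f. dom f \<subseteq> Field lam \<Longrightarrow> ran f \<subseteq> Field lam \<Longrightarrow>
           f \<in> F \<longleftrightarrow> (\<forall>u. u \<subseteq> dom f \<and> countable u \<longrightarrow> f |` u \<in> F)"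
    and "\<not> (\<exists>f\<in>F. dom f = Field lam)"
  shows "\<exists>(V :: 'a set vocabulary) (M1 :: ('a set, 'a) model) (M2 :: ('a set, 'a) model).
           is_model V M1 \<and> is_model V M2 \<and>
           |univ M1| =o lam \<and> |univ M2| =o lam \<and>
           \<not> isomorphic V M1 M2 \<and>
           EF_equivalent (tree_of lam F) cone V M1 M2"
proof -
  let ?D = "Field lam \<times> Field lam" and ?E = "Field lam \<times> (UNIV :: nat set) \<times> Field lam"
  let ?K = "local_threads lam F"
  have natLeq: "natLeq <o lam" using assms(1-3) by (rule natLeq_ordLess_if_cexp_eq)
  have FieldI: "|Field lam| =o lam" using assms(1) by (rule card_of_Field_ordIso)
  have nat: "|UNIV :: nat set| \<le>o lam"
    using natLeq card_of_nat ordIso_ordLess_trans ordLess_imp_ordLeq by blast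
  have inf: "infinite (Field lam)"
    using card_of_ordLeq_infinite[of "UNIV :: nat set" "Field lam"] nat FieldI
      ordIso_symmetric ordLeq_ordIso_trans infinite_UNIV_nat by blast
  have pow: "lam ^c natLeq \<le>o lam" using assms(3) ordIso_symmetric ordIso_imp_ordLeq by blast
  have D: "|?D| =o lam"
    using card_of_Times_same_infinite[OF inf] FieldI ordIso_transitive by blast
  have E: "|?E| \<le>o lam"
    using inf nat assms(1) ordIso_imp_ordLeq[OF FieldI]
    by (intro card_of_Times_ordLeq_infinite_Field)
  have "|fibre_points ?D ?E| =o lam"
    using assms(1) inf pow D E by (rule card_of_fibre_points)
  hence "|fibre_points ?D ?E| =o |Field lam|"
    using FieldI ordIso_symmetric ordIso_transitive by blast
  \<comment> \<open>A bijection onto \<open>Field lam\<close>, rather than a mere injection, makes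
    \<open>Field lam\<close> the universe of both models.\<close>
  then obtain enc where enc: "bij_betw enc (fibre_points ?D ?E) (Field lam)"
    using card_of_ordIso by blast
  then interpret encoded_fibres ?D ?E ?K enc
    by unfold_locales (rule bij_betw_imp_inj_on)
  have univ: "univ (parity_model \<epsilon>) = Field lam" for \<epsilon>
    using enc by (simp add: bij_betw_def)
  have "\<not> isomorphic binary_vocabulary (parity_model False) (parity_model True)"
    by (rule parity_models_not_isomorphic)
      (use no_thread_local_threads[OF assms(1) natLeq assms(4,5,6)] in blast)
  moreover have "EF_equivalent (tree_of lam F) cone binary_vocabulary
      (parity_model False) (parity_model True)"
    using inj_enc assms(4) by (rule EF_equivalent_parity_models)
  moreover have "|univ (parity_model \<epsilon>)| =o lam" for \<epsilon>
    unfolding univ by (rule FieldI)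
  ultimately show ?thesis using is_model_parity by blast
qed

end
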